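(* Let $r\ge1$ and $a,b,\iota\in\mathbb C$. For $\delta\in\mathbb C$ put $$m_\delta=\prod_{j=1}^r\big(\delta+a(j-1)\big)\big(\delta-1+\iota+2b+a(r-j)\big),\qquad \mathcal M_\delta=\prod_{j=1}^r\big(D_j^2-(\delta+\rho_1)^2\big),$$ where $D_1,\dots,D_r$ are the Cherednik operators with parameters $(a,2b,\iota)$. Then the following Bernstein–Sato type identity holds: $$\mathcal M_\delta|\mathrm{SH}(t)|^\delta=m_\delta\,|\mathrm{SH}(t)|^{\delta-2},\qquad t=(t_1,\dots,t_r)\in\mathbb R^r,\ t_j\neq0\ \text{ for all } j .$$
   Context: $\mathrm{SH}(t)=\prod_{j=1}^r\sinh t_j$ for $t=(t_1,\dots,t_r)=t_1\xi_1+\dots+t_r\xi_r\in\mathfrak a=\mathbb R^r$. The root system on $\mathfrak a$ has roots $\pm\xi_i^*\pm\xi_j^*$ ($i\ne j$), $\pm\xi_j^*$, $\pm2\xi_j^*$ with (general complex) multiplicities $a$, $2b$, $\iota$ respectively, where $\{\xi_j^*\}$ is the dual basis of $\{\xi_j\}$ and $\xi_1^*>\dots>\xi_r^*>0$. The half sum of positive roots is $\rho=\sum_j\rho_j\xi_j^*$ with $\rho_j=\iota+b+a(r-j)$. The Cherednik operators act on functions of $t$ by $$D_j=\partial_j-a\sum_{i<j}\frac{1-s_{ij}}{1-e^{-2(t_i-t_j)}}+a\sum_{j<k}\frac{1-s_{jk}}{1-e^{-2(t_j-t_k)}}+a\sum_{k\ne j}\frac{1-\sigma_{jk}}{1-e^{-2(t_j+t_k)}}+2\iota\frac{1-\sigma_j}{1-e^{-4t_j}}+2b\frac{1-\sigma_j}{1-e^{-2t_j}}-\rho_j,$$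 where $\partial_j=\partial/\partial t_j$, and $s_{ij},\sigma_{ij},\sigma_j$ are the Weyl group elements acting on functions by substitution: $s_{ij}$ interchanges $\xi_i$ and $\xi_j$; $\sigma_{ij}$ sends $\xi_i\mapsto-\xi_j$, $\xi_j\mapsto-\xi_i$; $\sigma_j$ sends $\xi_j\mapsto-\xi_j$; all other $\xi_k$ are fixed. (The quotients are extended by continuity across the hyperplanes $t_i=\pm t_j$.) *)

theory Defs
  imports "HOL-Analysis.Analysis"
begin

text \<open>
  The space \<open>\<real>\<^sup>r\<close> is \<open>real ^ 'n\<close> with \<open>r = CARD('n)\<close>. The linear order on the index type plays the
  role of the order of the indices \<open>1, \<dots>, r\<close>, and \<open>idx j \<in> {1..r}\<close> is the position of \<open>j\<close>.
  Operators act on all functions \<open>real ^ 'n \<Rightarrow> complex\<close>. At a point with nonzero coordinates, their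
  values depend only on the function on the open, Weyl-invariant set of all such points.
\<close>

definition idx :: "'n::{finite,linorder} \<Rightarrow> nat"
  where "idx j = card {..j}"

definition SH :: "real ^ 'n::finite \<Rightarrow> real"
  where "SH t = (\<Prod>j\<in>UNIV. sinh (t $ j))"

definition rho :: "complex \<Rightarrow> complex \<Rightarrow> complex \<Rightarrow> 'n::{finite,linorder} \<Rightarrow> complex"
  where "rho a b \<iota> j = \<iota> + b + a * (of_nat CARD('n) - of_nat (idx j))"

text \<open>
  The reflections are involutions, so a reflection \<open>w\<close> acts on functions by \<open>f \<mapsto> (\<lambda>t. f (w t))\<close>.
\<close>

definition swap :: "'n::finite \<Rightarrow> 'n \<Rightarrow> real ^ 'n \<Rightarrow> real ^ 'n"
  where "swap i j t = (\<chi> k. if k = i then t $ j else if k = j then t $ i else t $ k)"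

definition neg_swap :: "'n::finite \<Rightarrow> 'n \<Rightarrow> real ^ 'n \<Rightarrow> real ^ 'n"
  where "neg_swap i j t = (\<chi> k. if k = i then - t $ j else if k = j then - t $ i else t $ k)"

definition neg_coord :: "'n::finite \<Rightarrow> real ^ 'n \<Rightarrow> real ^ 'n"
  where "neg_coord j t = (\<chi> k. if k = j then - t $ k else t $ k)"

text \<open>
  The quotient \<open>(1 - w) / (1 - e\<^sup>-\<^sup>\<phi>)\<close> for a linear form \<open>\<phi>\<close>, extended by continuity across the
  hyperplane \<open>\<phi> = 0\<close>.
\<close>

definition quot :: "(real ^ 'n::finite \<Rightarrow> real ^ 'n) \<Rightarrow> (real ^ 'n \<Rightarrow> real) \<Rightarrow>
    (real ^ 'n \<Rightarrow> complex) \<Rightarrow> real ^ 'n \<Rightarrow> complex"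
  where "quot w \<phi> f t =
    (let q = (\<lambda>u. (f u - f (w u)) / complex_of_real (1 - exp (- \<phi> u)))
     in if \<phi> t \<noteq> 0 then q t else Lim (at t within {u. \<phi> u \<noteq> 0}) q)"

definition partial :: "'n::finite \<Rightarrow> (real ^ 'n \<Rightarrow> complex) \<Rightarrow> real ^ 'n \<Rightarrow> complex"
  where "partial j f t = vector_derivative (\<lambda>h. f (t + h *\<^sub>R axis j 1)) (at 0)"

text \<open>
  The multiplicities of the roots \<open>\<plusminus>\<xi>\<^sub>i\<^sup>* \<plusminus> \<xi>\<^sub>j\<^sup>*\<close>, \<open>\<plusminus>\<xi>\<^sub>j\<^sup>*\<close>, \<open>\<plusminus>2\<xi>\<^sub>j\<^sup>*\<close> are \<open>a\<close>, \<open>2 * b\<close> and \<open>\<iota>\<close>.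
\<close>

definition cherednik :: "complex \<Rightarrow> complex \<Rightarrow> complex \<Rightarrow> 'n::{finite,linorder} \<Rightarrow>
    (real ^ 'n::{finite,linorder} \<Rightarrow> complex) \<Rightarrow> real ^ 'n::{finite,linorder} \<Rightarrow> complex"
  where "cherednik a b \<iota> j f t =
      partial j f t
      - a * (\<Sum>i | i < j. quot (swap i j) (\<lambda>u. 2 * (u $ i - u $ j)) f t)
      + a * (\<Sum>k | j < k. quot (swap j k) (\<lambda>u. 2 * (u $ j - u $ k)) f t)
      + a * (\<Sum>k | k \<noteq> j. quot (neg_swap j k) (\<lambda>u. 2 * (u $ j + u $ k)) f t)
      + 2 * \<iota> * quot (neg_coord j) (\<lambda>u. 4 * u $ j) f t
      + 2 * b * quot (neg_coord j) (\<lambda>u. 2 * u $ j) f t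
      - rho a b \<iota> j * f t"

text \<open>
  The factors of \<open>\<M>\<^sub>\<delta>\<close> are composed in the order of the indices, the one for \<open>j = 1\<close> outermost.
  Here \<open>Min UNIV\<close> is the first index.
\<close>

definition M_factor :: "complex \<Rightarrow> complex \<Rightarrow> complex \<Rightarrow> complex \<Rightarrow> 'n::{finite,linorder} \<Rightarrow>
    (real ^ 'n::{finite,linorder} \<Rightarrow> complex) \<Rightarrow> real ^ 'n::{finite,linorder} \<Rightarrow> complex"
  where "M_factor a b \<iota> \<delta> j f =
    (\<lambda>t. cherednik a b \<iota> j (cherednik a b \<iota> j f) t - (\<delta> + rho a b \<iota> (Min (UNIV :: 'n set)))\<^sup>2 * f t)"

definition M_op :: "complex \<Rightarrow> complex \<Rightarrow> complex \<Rightarrow> complex \<Rightarrow>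
    (real ^ 'n::{finite,linorder} \<Rightarrow> complex) \<Rightarrow> real ^ 'n::{finite,linorder} \<Rightarrow> complex"
  where "M_op a b \<iota> \<delta> = foldr (M_factor a b \<iota> \<delta>) (sorted_list_of_set (UNIV :: 'n set))"

definition m_const :: "'n::{finite,linorder} itself \<Rightarrow> complex \<Rightarrow> complex \<Rightarrow> complex \<Rightarrow> complex \<Rightarrow> complex"
  where "m_const _ a b \<iota> \<delta> = (\<Prod>j\<in>(UNIV :: 'n set).
    (\<delta> + a * (of_nat (idx j) - 1)) * (\<delta> - 1 + \<iota> + 2 * b + a * (of_nat CARD('n) - of_nat (idx j))))"

end

(*
  With x_j = coth t_j, the Cherednik operators act on functions p(x) |SH|^delta through operators
  D_j on polynomials p, and |SH|^(-2) = prod (x_j^2 - 1). Each factor splits as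
  D_j^2 - c^2 = (D_j - c) (D_j + c) with c = delta + rho_1. As the D_j commute, M_delta is
  (D_1 - c) ... (D_r - c) (D_r + c) ... (D_1 + c). In this order every step is explicit: D_j + c maps
  prod_{i<j} (x_i + 1) to (delta + a (j - 1)) prod_{i<=j} (x_i + 1), and then D_j - c multiplies
  prod_i (x_i + 1) prod_{k>j} (x_k - 1) by (delta - 1 + iota + 2 b + a (r - j)) (x_j - 1).
  Commutativity reduces to relations for root subsystems of rank two, checked at points off all
  reflection hyperplanes; identities between polynomials extend from there by density.
*)
theory Submission
  imports Defs
begin

subsection \<open>Polynomial functions and regular points\<close>

text \<open>Three facts single out x_j = coth t_j. |SH|^delta is invariant under the Weyl group, so
  reflections act on the factor p alone; the logarithmic derivative of |SH|^delta along t_j is delta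
  x_j; and 1/(1 - e^(-2(s - t))) is a rational function of coth s and coth t. Commutation is
  therefore an algebraic matter, treated for all real x off the hyperplanes and not only for |x_j| >
  1. The obstacle is iteration: every later operator is applied to a function whose values on t_i =
  t_j or t_i = -t_j are limits. So each D_j has to send polynomials to polynomials, while its
  formula with rational coefficients gives the right value only off the hyperplanes, because of
  division by zero. Hence two notions coexist: true polynomials (\<open>polyf\<close>), used for
  continuity, and functions that agree with a polynomial at regular points (\<open>regpoly\<close>),
  on which the algebra is done. The same constant c serves all j because rho_1 - rho_j = a (j - 1)
  is exactly what the indices i < j contribute to the coefficient of x_j in the step of D_j +
  c.\<close>

inductive polyf :: "(real ^ 'n::finite \<Rightarrow> complex) \<Rightarrow> bool" where
  polyf_const: "polyf (\<lambda>x. c)"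
| polyf_coord: "polyf (\<lambda>x. complex_of_real (x $ i))"
| polyf_add: "polyf P \<Longrightarrow> polyf Q \<Longrightarrow> polyf (\<lambda>x. P x + Q x)"
| polyf_mult: "polyf P \<Longrightarrow> polyf Q \<Longrightarrow> polyf (\<lambda>x. P x * Q x)"

lemma polyf_uminus: "polyf P \<Longrightarrow> polyf (\<lambda>x. - P x)"
  using polyf_mult[OF polyf_const[of "-1"]] by simp

lemma polyf_diff: "polyf P \<Longrightarrow> polyf Q \<Longrightarrow> polyf (\<lambda>x. P x - Q x)"
  using polyf_add[OF _ polyf_uminus] by fastforce

lemma polyf_power: "polyf P \<Longrightarrow> polyf (\<lambda>x. P x ^ n)"
  by (induction n) (auto intro: polyf_const polyf_mult)

lemma polyf_sum: "(\<And>k. k \<in> A \<Longrightarrow> polyf (P k)) \<Longrightarrow> polyf (\<lambda>x. \<Sum>k\<in>A. P k x)"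
  by (induction A rule: infinite_finite_induct) (auto intro: polyf_const polyf_add)

lemma polyf_prod: "(\<And>k. k \<in> A \<Longrightarrow> polyf (P k)) \<Longrightarrow> polyf (\<lambda>x. \<Prod>k\<in>A. P k x)"
  by (induction A rule: infinite_finite_induct) (auto intro: polyf_const polyf_mult)

lemmas polyf_intros = polyf_const polyf_coord polyf_add polyf_mult polyf_uminus polyf_diff
  polyf_power polyf_sum polyf_prod

lemma polyf_compose:
  assumes "polyf P" "\<And>k. polyf (\<lambda>x. complex_of_real (w x $ k))"
  shows "polyf (\<lambda>x. P (w x))"
  using assms(1) by induction (auto intro: polyf_intros assms(2))

lemma continuous_polyf: "polyf P \<Longrightarrow> continuous_on A P"
  by (induction rule: polyf.induct) (auto intro!: continuous_intros)

text \<open>Divided differences satisfy a twisted Leibniz rule, P1 P2 - (P1 P2) o w = (P1 - P1 o w)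
  P2 + (P1 o w) (P2 - P2 o w), so divisibility by \<open>l\<close> has to be known on the
  coordinates only. No division occurs, hence \<open>Q\<close> is meaningful where \<open>l\<close>
  vanishes.\<close>

lemma polyf_quotient:
  assumes "polyf P" "\<And>k. polyf (\<lambda>x. complex_of_real (w x $ k))"
    and "\<And>k. \<exists>c. \<forall>x. x $ k - w x $ k = c * l x"
  shows "\<exists>Q. polyf Q \<and> (\<forall>x. P x - P (w x) = complex_of_real (l x) * Q x)"
  using assms(1)
proof induction
  case (polyf_const c)
  show ?case by (rule exI[of _ "\<lambda>x. 0"]) (auto intro: polyf_intros)
next
  case (polyf_coord i)
  obtain c where c: "\<And>x. x $ i - w x $ i = c * l x" using assms(3) by blast
  show ?case
    by (rule exI[of _ "\<lambda>x. of_real c"])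
       (auto intro: polyf_intros simp flip: of_real_diff of_real_mult simp: c)
next
  case (polyf_add P1 P2)
  then obtain Q1 Q2 where Q: "polyf Q1" "\<And>x. P1 x - P1 (w x) = complex_of_real (l x) * Q1 x"
    "polyf Q2" "\<And>x. P2 x - P2 (w x) = complex_of_real (l x) * Q2 x" by auto
  have "P1 x + P2 x - (P1 (w x) + P2 (w x)) = complex_of_real (l x) * (Q1 x + Q2 x)" for x
    using Q(2)[of x] Q(4)[of x] by algebra
  then show ?case using polyf.polyf_add[OF Q(1,3)] by blast
next
  case (polyf_mult P1 P2)
  then obtain Q1 Q2 where Q: "polyf Q1" "\<And>x. P1 x - P1 (w x) = complex_of_real (l x) * Q1 x"
    "polyf Q2" "\<And>x. P2 x - P2 (w x) = complex_of_real (l x) * Q2 x" by auto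
  have "P1 x * P2 x - P1 (w x) * P2 (w x)
      = complex_of_real (l x) * (Q1 x * P2 x + P1 (w x) * Q2 x)" for x
    using Q(2)[of x] Q(4)[of x] by algebra
  moreover have "polyf (\<lambda>x. Q1 x * P2 x + P1 (w x) * Q2 x)"
    by (intro polyf_intros polyf_compose[of P1 w] Q polyf_mult assms)
  ultimately show ?case by blast
qed

text \<open>The complement of the reflection hyperplanes of type BC, in the coordinates x. Since
  coth is odd and injective off 0, t_i = t_j and t_i = -t_j correspond to x_i = x_j and x_i =
  -x_j.\<close>

definition reg :: "real ^ 'n::finite \<Rightarrow> bool"
  where "reg x \<longleftrightarrow> (\<forall>i j. i \<noteq> j \<longrightarrow> x $ i \<noteq> x $ j \<and> x $ i \<noteq> - x $ j) \<and> (\<forall>j. x $ j \<noteq> 0)"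

lemma eventually_line_nonzero:
  fixes p q :: real
  assumes "q \<noteq> 0"
  shows "\<forall>\<^sub>F h in at 0. p + h * q \<noteq> 0"
proof (cases "p = 0")
  case True
  then show ?thesis using assms by (auto simp: eventually_at_filter)
next
  case False
  have "((\<lambda>h. p + h * q) \<longlongrightarrow> p + 0 * q) (at 0)" by (intro tendsto_intros)
  then have "\<forall>\<^sub>F h in at 0. p + h * q \<in> - {0}"
    using False by (intro topological_tendstoD) auto
  then show ?thesis by simp
qed

lemma reg_dense_direction:
  obtains v :: "real ^ 'n::finite" where "\<And>x. \<forall>\<^sub>F h in at 0. reg (x + h *\<^sub>R v)"
proof -
  obtain e :: "'n \<Rightarrow> nat" where e: "inj e"
    using finite_imp_inj_to_nat_seg[of "UNIV :: 'n set"] by auto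
  \<comment> \<open>Distinct positive entries make the line through any point transversal to every
    hyperplane x_i = x_j, x_i = -x_j, x_j = 0, so it meets each of them at most once.\<close>
  define v :: "real ^ 'n" where "v = (\<chi> i. real (e i) + 1)"
  have pos: "v $ i > 0" for i by (simp add: v_def)
  have "\<forall>\<^sub>F h in at 0. reg (x + h *\<^sub>R v)" for x
  proof -
    have "\<forall>\<^sub>F h in at 0. i \<noteq> j \<longrightarrow> (x $ i - x $ j) + h * (v $ i - v $ j) \<noteq> 0" for i j
      by (cases "i = j") (auto intro!: eventually_line_nonzero simp: v_def inj_eq[OF e])
    moreover have "\<forall>\<^sub>F h in at 0. i \<noteq> j \<longrightarrow> (x $ i + x $ j) + h * (v $ i + v $ j) \<noteq> 0" for i j
      using eventually_line_nonzero[of "v $ i + v $ j" "x $ i + x $ j"] pos[of i] pos[of j]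
      by (auto elim: eventually_mono)
    moreover have "\<forall>\<^sub>F h in at 0. x $ j + h * v $ j \<noteq> 0" for j
      using eventually_line_nonzero[of "v $ j"] pos[of j] by auto
    ultimately have "\<forall>\<^sub>F h in at 0. \<forall>i j.
        (i \<noteq> j \<longrightarrow> (x $ i - x $ j) + h * (v $ i - v $ j) \<noteq> 0) \<and>
        (i \<noteq> j \<longrightarrow> (x $ i + x $ j) + h * (v $ i + v $ j) \<noteq> 0) \<and> x $ j + h * v $ j \<noteq> 0"
      by (intro eventually_all_finite eventually_conj)
    then show ?thesis
    proof eventually_elim
      case (elim h)
      have "(x + h *\<^sub>R v) $ i \<noteq> (x + h *\<^sub>R v) $ j \<and> (x + h *\<^sub>R v) $ i \<noteq> - (x + h *\<^sub>R v) $ j"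
        if "i \<noteq> j" for i j
      proof -
        have "(x $ i - x $ j) + h * (v $ i - v $ j) \<noteq> 0"
          "(x $ i + x $ j) + h * (v $ i + v $ j) \<noteq> 0" using elim that by blast+
        then show ?thesis
          unfolding right_diff_distrib distrib_left vector_add_component vector_scaleR_component
            real_scaleR_def by linarith
      qed
      then show ?case using elim unfolding reg_def by simp
    qed
  qed
  then show ?thesis using that by blast
qed

text \<open>Every point is a limit of regular points along a line, and polynomials are
  continuous.\<close>

lemma polyf_eqI:
  fixes P Q :: "real ^ 'n::finite \<Rightarrow> complex"
  assumes "polyf P" "polyf Q" "\<And>x. reg x \<Longrightarrow> P x = Q x"
  shows "P = Q"
proof
  fix x
  obtain v :: "real ^ 'n" where v: "\<forall>\<^sub>F h in at 0. reg (x + h *\<^sub>R v)" using reg_dense_direction by metis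
  have lim: "((\<lambda>h. F (x + h *\<^sub>R v)) \<longlongrightarrow> F x) (at 0)" if "polyf F" for F
  proof -
    have "isCont F x"
      using continuous_polyf[OF that, of UNIV] by (simp add: continuous_on_eq_continuous_at)
    moreover have "((\<lambda>h. x + h *\<^sub>R v) \<longlongrightarrow> x + 0 *\<^sub>R v) (at 0)" by (intro tendsto_intros)
    ultimately show ?thesis by (intro isCont_tendsto_compose[where g = F]) simp_all
  qed
  have "\<forall>\<^sub>F h in at 0. Q (x + h *\<^sub>R v) = P (x + h *\<^sub>R v)"
    using v by eventually_elim (simp add: assms(3))
  then have "((\<lambda>h. Q (x + h *\<^sub>R v)) \<longlongrightarrow> P x) (at 0)"
    using lim[OF assms(1)] by (rule tendsto_cong[THEN iffD2])
  then show "P x = Q x" using lim[OF assms(2)] LIM_unique by blast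
qed

lemma open_reg: "open {x :: real ^ 'n::finite. reg x}"
proof -
  have "{x :: real ^ 'n. reg x} =
    (\<Inter>i. \<Inter>j. {x. i = j} \<union> ({x. x $ i \<noteq> x $ j} \<inter> {x. x $ i \<noteq> - x $ j})) \<inter> (\<Inter>j. {x. x $ j \<noteq> 0})"
    by (auto simp: reg_def split: if_splits; metis)
  then show ?thesis
    by (auto intro!: open_INT open_Int open_Un open_Collect_neq continuous_intros open_Collect_const
          split: if_splits)
qed

text \<open>Stated for \<open>nhds 0\<close> and not \<open>at 0\<close>, because replacing a
  function under a derivative needs equality at the base point too.\<close>

lemma reg_eventually_line:
  assumes "reg x"
  shows "\<forall>\<^sub>F h in nhds 0. reg (x + h *\<^sub>R v)"
proof -
  have "isCont (\<lambda>h::real. x + h *\<^sub>R v) 0" by (intro continuous_intros)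
  then have "((\<lambda>h. x + h *\<^sub>R v) \<longlongrightarrow> x) (nhds 0)"
    by (simp add: continuous_at tendsto_nhds_iff)
  from topological_tendstoD[OF this open_reg] assms show ?thesis by simp
qed

section \<open>Coordinate derivatives of polynomials\<close>

lemma polyf_has_partial:
  fixes P :: "real ^ 'n::finite \<Rightarrow> complex"
  assumes "polyf P"
  shows "\<exists>P'. polyf P' \<and>
    (\<forall>x. ((\<lambda>h. P (x + h *\<^sub>R axis j 1)) has_vector_derivative P' x) (at 0))"
  using assms
proof induction
  case (polyf_const c)
  show ?case by (rule exI[of _ "\<lambda>x. 0"]) (auto intro: polyf_intros derivative_eq_intros)
next
  case (polyf_coord i)
  have "((\<lambda>h. complex_of_real ((x + h *\<^sub>R axis j 1) $ i)) has_vector_derivative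
      of_real (if i = j then 1 else 0)) (at 0)" for x
    by (rule has_vector_derivative_of_real)
       (auto simp: axis_def has_real_derivative_iff_has_vector_derivative[symmetric]
             intro!: derivative_eq_intros)
  then show ?case
    by (intro exI[of _ "\<lambda>x. of_real (if i = j then 1 else 0)"]) (auto intro: polyf_intros)
next
  case (polyf_add P1 P2)
  then obtain Q1 Q2 where "polyf Q1" "polyf Q2"
    "\<And>x. ((\<lambda>h. P1 (x + h *\<^sub>R axis j 1)) has_vector_derivative Q1 x) (at 0)"
    "\<And>x. ((\<lambda>h. P2 (x + h *\<^sub>R axis j 1)) has_vector_derivative Q2 x) (at 0)" by auto
  then show ?case
    by (intro exI[of _ "\<lambda>x. Q1 x + Q2 x"]) (simp add: polyf.polyf_add has_vector_derivative_add)
next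
  case (polyf_mult P1 P2)
  then obtain Q1 Q2 where Q: "polyf Q1" "polyf Q2"
    "\<And>x. ((\<lambda>h. P1 (x + h *\<^sub>R axis j 1)) has_vector_derivative Q1 x) (at 0)"
    "\<And>x. ((\<lambda>h. P2 (x + h *\<^sub>R axis j 1)) has_vector_derivative Q2 x) (at 0)" by auto
  have "((\<lambda>h. P1 (x + h *\<^sub>R axis j 1) * P2 (x + h *\<^sub>R axis j 1)) has_vector_derivative
      P1 x * Q2 x + Q1 x * P2 x) (at 0)" for x
    using has_vector_derivative_mult[OF Q(3,4)] by simp
  moreover have "polyf (\<lambda>x. P1 x * Q2 x + Q1 x * P2 x)"
    by (intro polyf_intros Q polyf_mult)
  ultimately show ?case by blast
qed

lemma polyf_partial: "polyf P \<Longrightarrow> polyf (partial j P)"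
  and has_partial_polyf: "polyf P \<Longrightarrow>
    ((\<lambda>h. P (x + h *\<^sub>R axis j 1)) has_vector_derivative partial j P x) (at 0)"
proof -
  assume "polyf P"
  from polyf_has_partial[OF this, of j] obtain P' where P': "polyf P'"
    "\<And>x. ((\<lambda>h. P (x + h *\<^sub>R axis j 1)) has_vector_derivative P' x) (at 0)" by auto
  then have "partial j P = P'" by (auto simp: partial_def fun_eq_iff vector_derivative_at)
  then show "polyf (partial j P)"
    "((\<lambda>h. P (x + h *\<^sub>R axis j 1)) has_vector_derivative partial j P x) (at 0)" using P' by auto
qed

text \<open>The derivative \<open>\<partial>/\<partial>t\<^sub>j\<close> in the coordinates \<open>x\<^sub>j = coth t\<^sub>j\<close>, as \<open>coth' = 1 - coth\<^sup>2\<close>.\<close>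

definition dx :: "'n::finite \<Rightarrow> (real ^ 'n \<Rightarrow> complex) \<Rightarrow> real ^ 'n \<Rightarrow> complex"
  where "dx j P x = of_real (1 - (x $ j)\<^sup>2) * partial j P x"

lemma polyf_dx: "polyf P \<Longrightarrow> polyf (dx j P)"
  unfolding dx_def[abs_def] of_real_diff of_real_power
  by (intro polyf_intros polyf_partial)

lemma dx_const: "dx j (\<lambda>x. c) = (\<lambda>x. 0)"
  by (simp add: fun_eq_iff dx_def partial_def)

lemma dx_coord:
  fixes j :: "'n::finite"
  shows "dx j (\<lambda>x. of_real (x $ i)) = (\<lambda>x. if i = j then of_real (1 - (x $ j)\<^sup>2) else 0)"
proof
  fix x :: "real ^ 'n"
  have "((\<lambda>h. complex_of_real ((x + h *\<^sub>R axis j 1) $ i)) has_vector_derivative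
      of_real (if i = j then 1 else 0)) (at 0)"
    by (rule has_vector_derivative_of_real)
       (auto simp: axis_def has_real_derivative_iff_has_vector_derivative[symmetric]
             intro!: derivative_eq_intros)
  then show "dx j (\<lambda>x. of_real (x $ i)) x = (if i = j then of_real (1 - (x $ j)\<^sup>2) else 0)"
    unfolding dx_def partial_def by (subst vector_derivative_at) auto
qed

lemma dx_add:
  assumes "polyf P" "polyf Q"
  shows "dx j (\<lambda>x. P x + Q x) = (\<lambda>x. dx j P x + dx j Q x)"
proof
  fix x
  have "partial j (\<lambda>x. P x + Q x) x = partial j P x + partial j Q x"
    unfolding partial_def[of j "\<lambda>x. P x + Q x"]
    by (intro vector_derivative_at has_vector_derivative_add has_partial_polyf assms)
  then show "dx j (\<lambda>x. P x + Q x) x = dx j P x + dx j Q x"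
    by (simp add: dx_def algebra_simps)
qed

lemma dx_mult:
  assumes "polyf P" "polyf Q"
  shows "dx j (\<lambda>x. P x * Q x) = (\<lambda>x. dx j P x * Q x + P x * dx j Q x)"
proof
  fix x
  have "partial j (\<lambda>x. P x * Q x) x = P x * partial j Q x + partial j P x * Q x"
    unfolding partial_def[of j "\<lambda>x. P x * Q x"]
    using has_vector_derivative_mult[OF has_partial_polyf[OF assms(1)] has_partial_polyf[OF assms(2)],
        of x j x j]
    by (intro vector_derivative_at) simp
  then show "dx j (\<lambda>x. P x * Q x) x = dx j P x * Q x + P x * dx j Q x"
    by (simp add: dx_def algebra_simps)
qed

lemma dx_cmult: "polyf P \<Longrightarrow> dx j (\<lambda>x. c * P x) = (\<lambda>x. c * dx j P x)"
  using dx_mult[OF polyf_const, of P j c] by (simp add: dx_const)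

lemma dx_diff:
  assumes "polyf P" "polyf Q"
  shows "dx j (\<lambda>x. P x - Q x) = (\<lambda>x. dx j P x - dx j Q x)"
  using dx_add[OF assms(1) polyf_mult[OF polyf_const assms(2)], of j "-1"]
    dx_cmult[OF assms(2), of j "-1"] by simp

text \<open>Regular points form an open set and a derivative is local. This allows differentiating a
  function known to be polynomial only at regular points.\<close>

lemma dx_cong_reg:
  assumes "reg x" "\<And>y. reg y \<Longrightarrow> P y = Q y"
  shows "dx j P x = dx j Q x"
proof -
  have "partial j P x = partial j Q x"
    unfolding partial_def using reg_eventually_line[OF assms(1), of "axis j 1"]
    by (intro vector_derivative_cong_eq) (auto elim: eventually_mono simp: assms(2))
  then show ?thesis by (simp add: dx_def)
qed

text \<open>The coefficient 1 - x_j^2 depends on x_j alone, so these derivations commute like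
  partial derivatives. Since the commutator of two derivations is again a derivation, induction over
  sums and products reduces the claim to coordinates.\<close>

lemma dx_commute:
  fixes i j :: "'n::finite"
  assumes "polyf P" "i \<noteq> j"
  shows "dx i (dx j P) = dx j (dx i P)"
  using assms(1)
proof induction
  case (polyf_const c)
  show ?case by (simp add: dx_const)
next
  case (polyf_coord k)
  have "dx i (\<lambda>x. of_real (1 - (x $ j)\<^sup>2)) = (\<lambda>x. 0)" if "i \<noteq> j" for i j :: 'n
    using that unfolding of_real_diff of_real_power power2_eq_square
    by (simp add: dx_diff dx_mult dx_coord dx_const polyf_intros)
  from this[OF assms(2)] this[OF assms(2)[symmetric]] show ?case
    using assms(2) by (cases "k = j"; cases "k = i") (simp_all add: dx_coord dx_const)
next
  case (polyf_add P Q)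
  then show ?case by (simp add: dx_add polyf_dx)
next
  case (polyf_mult P Q)
  then show ?case by (simp add: dx_add dx_mult polyf_dx polyf_intros algebra_simps)
qed

subsection \<open>Reflection operators in the coordinates coth\<close>

definition refl_op :: "(real ^ 'n \<Rightarrow> complex) \<Rightarrow> (real ^ 'n::finite \<Rightarrow> real ^ 'n) \<Rightarrow>
    (real ^ 'n \<Rightarrow> complex) \<Rightarrow> real ^ 'n \<Rightarrow> complex"
  where "refl_op c w P x = c x * (P x - P (w x))"

text \<open>For \<open>u = coth s\<close> and \<open>v = coth t\<close>, \<open>long_coeff u v = 1 / (1 - e\<^sup>-\<^sup>2\<^sup>(\<^sup>s\<^sup>-\<^sup>t\<^sup>))\<close> and
  \<open>short_coeff b \<iota> u = 2\<iota> / (1 - e\<^sup>-\<^sup>4\<^sup>s) + 2b / (1 - e\<^sup>-\<^sup>2\<^sup>s)\<close>.\<close>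

definition long_coeff :: "complex \<Rightarrow> complex \<Rightarrow> complex"
  where "long_coeff u v = (1 + u) * (1 - v) / (2 * (u - v))"

definition short_coeff :: "complex \<Rightarrow> complex \<Rightarrow> complex \<Rightarrow> complex"
  where "short_coeff b \<iota> u = \<iota> * (1 + u)\<^sup>2 / (2 * u) + b * (1 + u)"

definition T_minus :: "'n::finite \<Rightarrow> 'n \<Rightarrow> (real ^ 'n \<Rightarrow> complex) \<Rightarrow> real ^ 'n \<Rightarrow> complex"
  where "T_minus i j = refl_op (\<lambda>x. long_coeff (of_real (x $ i)) (of_real (x $ j))) (swap i j)"

definition T_plus :: "'n::finite \<Rightarrow> 'n \<Rightarrow> (real ^ 'n \<Rightarrow> complex) \<Rightarrow> real ^ 'n \<Rightarrow> complex"
  where "T_plus i j = refl_op (\<lambda>x. long_coeff (of_real (x $ i)) (- of_real (x $ j))) (neg_swap i j)"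

definition T_short :: "complex \<Rightarrow> complex \<Rightarrow> 'n::finite \<Rightarrow> (real ^ 'n \<Rightarrow> complex) \<Rightarrow> real ^ 'n \<Rightarrow> complex"
  where "T_short b \<iota> j = refl_op (\<lambda>x. short_coeff b \<iota> (of_real (x $ j))) (neg_coord j)"

lemma swap_nth: "swap i j x $ k = (if k = i then x $ j else if k = j then x $ i else x $ k)"
  and neg_swap_nth: "neg_swap i j x $ k = (if k = i then - x $ j else if k = j then - x $ i else x $ k)"
  and neg_coord_nth: "neg_coord i x $ k = (if k = i then - x $ k else x $ k)"
  by (simp_all add: swap_def neg_swap_def neg_coord_def)

lemmas refl_nth = swap_nth neg_swap_nth neg_coord_nth

lemma reg_nonzero: "reg x \<Longrightarrow> x $ i \<noteq> 0"
  and reg_distinct: "reg x \<Longrightarrow> i \<noteq> j \<Longrightarrow> x $ i \<noteq> x $ j"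
  and reg_distinct_neg: "reg x \<Longrightarrow> i \<noteq> j \<Longrightarrow> x $ i \<noteq> - x $ j"
  and reg_distinct_add: "reg x \<Longrightarrow> i \<noteq> j \<Longrightarrow> x $ i + x $ j \<noteq> 0"
  by (auto simp: reg_def add_eq_0_iff2)

lemma reg_signed_perm:
  assumes "reg x" "inj p" "\<And>k. y $ k = x $ p k \<or> y $ k = - x $ p k"
  shows "reg y"
proof -
  have "y $ i \<noteq> y $ j \<and> y $ i \<noteq> - y $ j" if "i \<noteq> j" for i j
    using assms(3)[of i] assms(3)[of j] reg_distinct[OF assms(1)]
      reg_distinct_neg[OF assms(1)] inj_eq[OF assms(2)] that
    by (metis minus_minus)
  moreover have "y $ j \<noteq> 0" for j
    using assms(3)[of j] reg_nonzero[OF assms(1), of "p j"] by auto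
  ultimately show ?thesis by (simp add: reg_def)
qed

lemma reg_refl:
  assumes "reg x"
  shows "reg (swap i j x)" "reg (neg_swap i j x)" "reg (neg_coord j x)"
proof -
  have "inj (\<lambda>k. if k = i then j else if k = j then i else k)"
    by (rule injI) (auto split: if_splits)
  then show "reg (swap i j x)" "reg (neg_swap i j x)"
    by (rule reg_signed_perm[OF assms]; simp add: refl_nth)+
  show "reg (neg_coord j x)"
    by (rule reg_signed_perm[OF assms, of id]) (auto simp: refl_nth)
qed

section \<open>Scalar identities of the coefficients and the rank two relations\<close>

lemma long_coeff_flip: "u \<noteq> v \<Longrightarrow> long_coeff v u = 1 - long_coeff u v"
  by (simp add: long_coeff_def divide_simps) (simp add: algebra_simps)

lemma long_coeff_neg: "long_coeff (- u) (- v) = long_coeff v u"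
proof -
  have "2 * (- u - - v) = 2 * (v - u)" by simp
  then show ?thesis by (simp only: long_coeff_def) (simp add: mult.commute)
qed

lemma long_coeff_eq: "u \<noteq> v \<Longrightarrow> 2 * (u - v) * long_coeff u v = (1 + u) * (1 - v)"
  by (simp add: long_coeff_def)

text \<open>The identity behind the rank two relations: with \<open>\<phi>(s) = 1 / (1 - e\<^sup>-\<^sup>2\<^sup>s)\<close> it reads
  \<open>\<phi>(s) \<phi>(t) = \<phi>(s + t) (\<phi>(s) + \<phi>(t) - 1)\<close>.\<close>

lemma long_coeff_triangle:
  assumes "u \<noteq> v" "v \<noteq> w" "u \<noteq> w"
  shows "long_coeff u v * long_coeff v w = long_coeff u w * (long_coeff u v + long_coeff v w - 1)"
proof -
  have "(u - v) * (v - w) * (u - w) * (long_coeff u v * long_coeff v w - long_coeff u w * (long_coeff u v + long_coeff v w - 1)) = 0"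
    using assms[THEN long_coeff_eq] by algebra
  then show ?thesis using assms by simp
qed

text \<open>As for \<open>long_coeff_flip\<close>: the values of 1/(1 - e^(-s)) at s and -s add up
  to 1, and the multiples occurring here are 2\<iota> and 2b.\<close>

lemma short_coeff_neg: "u \<noteq> 0 \<Longrightarrow> short_coeff b \<iota> (- u) = 2 * \<iota> + 2 * b - short_coeff b \<iota> u"
  by (simp add: short_coeff_def divide_simps) algebra

text \<open>The scalar identity behind the relation of type BC_2. Its \<iota> part, in the
  coordinates s, t, is the sum of two triangle identities: for 2s = (s - t) + (s + t) and for s + t
  = 2t + (s - t).\<close>

lemma short_coeff_long_coeff:
  assumes "u \<noteq> 0" "v \<noteq> 0" "u \<noteq> v" "u \<noteq> - v"
  shows "short_coeff b \<iota> u * (long_coeff u v + long_coeff u (- v) - 1) + short_coeff b \<iota> v * (long_coeff u (- v) - long_coeff u v)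
    = (2 * \<iota> + 2 * b) * long_coeff u (- v)"
proof -
  have "2 * u * short_coeff b \<iota> u = \<iota> * (1 + u)\<^sup>2 + 2 * u * b * (1 + u)"
    "2 * v * short_coeff b \<iota> v = \<iota> * (1 + v)\<^sup>2 + 2 * v * b * (1 + v)"
    using assms by (simp_all add: short_coeff_def field_simps)
  then have "u * v * (u - v) * (u - - v) * (short_coeff b \<iota> u * (long_coeff u v + long_coeff u (- v) - 1)
      + short_coeff b \<iota> v * (long_coeff u (- v) - long_coeff u v) - (2 * \<iota> + 2 * b) * long_coeff u (- v)) = 0"
    using long_coeff_eq[OF assms(3)] long_coeff_eq[OF assms(4)] by algebra
  moreover have "u - - v \<noteq> 0" using assms(4) by (metis right_minus_eq)
  ultimately show ?thesis using assms by simp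
qed

text \<open>The relation of the reflection operators for positive roots \<open>\<alpha>\<close>, \<open>\<beta>\<close>, \<open>\<gamma> = \<alpha> + \<beta>\<close> spanning a system of type
  \<open>A\<^sub>2\<close>, indexed by 1, 2, 3; \<open>y\<close> and \<open>z\<close> are the two rotations of \<open>x\<close>.\<close>

lemma refl_op_A2:
  fixes r1 :: "real ^ 'n::finite \<Rightarrow> real ^ 'n"
  assumes "r2 (r1 x) = y" "r1 (r3 x) = y" "r3 (r2 x) = y"
    and "r1 (r2 x) = z" "r2 (r3 x) = z" "r3 (r1 x) = z"
    and "c2 (r1 x) = c3 x" "c3 (r1 x) = c2 x" "c1 (r2 x) = c3 x" "c3 (r2 x) = c1 x"
    and "c1 (r3 x) = 1 - c2 x" "c2 (r3 x) = 1 - c1 x"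
    and key: "c1 x * c2 x = c3 x * (c1 x + c2 x - 1)"
  shows "refl_op c1 r1 (refl_op c2 r2 P) x - refl_op c2 r2 (refl_op c1 r1 P) x
    + (refl_op c1 r1 (refl_op c3 r3 P) x - refl_op c3 r3 (refl_op c1 r1 P) x)
    + (refl_op c3 r3 (refl_op c2 r2 P) x - refl_op c2 r2 (refl_op c3 r3 P) x) = 0"
  unfolding refl_op_def assms using key by algebra

text \<open>The roots on three indices form a system of type D_3, which has four subsystems of type
  A_2. The sum root is p - m, p + m, p + q and p + q respectively.\<close>

lemma T_minus_T_plus_A2:
  assumes "reg x" "p \<noteq> q" "p \<noteq> m" "q \<noteq> m"
  shows "T_minus p q (T_minus q m P) x - T_minus q m (T_minus p q P) x + (T_minus p q (T_minus p m P) x - T_minus p m (T_minus p q P) x)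
      + (T_minus p m (T_minus q m P) x - T_minus q m (T_minus p m P) x) = 0"
    and "T_minus p q (T_plus q m P) x - T_plus q m (T_minus p q P) x + (T_minus p q (T_plus p m P) x - T_plus p m (T_minus p q P) x)
      + (T_plus p m (T_plus q m P) x - T_plus q m (T_plus p m P) x) = 0"
    and "T_plus p m (T_minus q m P) x - T_minus q m (T_plus p m P) x + (T_plus p m (T_plus p q P) x - T_plus p q (T_plus p m P) x)
      + (T_plus p q (T_minus q m P) x - T_minus q m (T_plus p q P) x) = 0"
    and "T_minus p m (T_plus q m P) x - T_plus q m (T_minus p m P) x + (T_minus p m (T_plus p q P) x - T_plus p q (T_minus p m P) x)
      + (T_plus p q (T_plus q m P) x - T_plus q m (T_plus p q P) x) = 0"
proof -
  define X Y Z where "X = complex_of_real (x $ p)" "Y = complex_of_real (x $ q)" "Z = complex_of_real (x $ m)"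
  have "X \<noteq> Y" "X \<noteq> Z" "Y \<noteq> Z" "X \<noteq> - Y" "X \<noteq> - Z" "Y \<noteq> - Z"
    "Z \<noteq> - Y"
    using assms reg_distinct[of x] reg_distinct_neg[of x]
    by (auto simp: X_Y_Z_def simp flip: of_real_minus)
  note d = this this[symmetric] \<open>X \<noteq> - Y\<close>[unfolded eq_neg_iff_add_eq_0]
  note [simp] = X_Y_Z_def[symmetric] 
  have f: "long_coeff Y X = 1 - long_coeff X Y" "long_coeff Z X = 1 - long_coeff X Z" "long_coeff Z Y = 1 - long_coeff Y Z"
    "long_coeff (- Y) X = 1 - long_coeff X (- Y)" "long_coeff (- Z) X = 1 - long_coeff X (- Z)" "long_coeff (- Z) Y = 1 - long_coeff Y (- Z)"
    using d by (auto intro!: long_coeff_flip)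
  have g: "long_coeff (- u) v = long_coeff (- v) u" for u v using long_coeff_neg[of u "- v"] by simp
  have f': "long_coeff (- X) Z = 1 - long_coeff X (- Z)" "long_coeff (- Y) Z = 1 - long_coeff Y (- Z)"
    using f g[of X Z] g[of Y Z] by simp_all
  have h: "long_coeff Y (- X) = long_coeff X (- Y)" "long_coeff Z (- X) = long_coeff X (- Z)" "long_coeff Z (- Y) = long_coeff Y (- Z)"
    using long_coeff_neg[of X "- Y"] long_coeff_neg[of X "- Z"] long_coeff_neg[of Y "- Z"] long_coeff_neg[of "- X" Y]  long_coeff_neg[of "- X" Z] long_coeff_neg[of "- Y" Z] by simp_all
  note ne = assms(2-4) assms(2-4)[symmetric]
  \<comment> \<open>In the last two subsystems the roots add up to p + q, so the triangle identity
    is taken at X, -Z, -Y and at X, Z, -Y, followed by the sign rules.\<close>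
  have t: "long_coeff X (- Z) * long_coeff Y Z = long_coeff X (- Y) * (long_coeff X (- Z) + long_coeff Y Z - 1)"
    using long_coeff_triangle[of X "- Z" "- Y"] d by (simp add: long_coeff_neg)
  have t': "long_coeff X Z * long_coeff Y (- Z) = long_coeff X (- Y) * (long_coeff X Z + long_coeff Y (- Z) - 1)"
    using long_coeff_triangle[of X Z "- Y"] d h \<open>X \<noteq> - Y\<close> \<open>Z \<noteq> - Y\<close> by simp
  show "T_minus p q (T_minus q m P) x - T_minus q m (T_minus p q P) x + (T_minus p q (T_minus p m P) x - T_minus p m (T_minus p q P) x)
      + (T_minus p m (T_minus q m P) x - T_minus q m (T_minus p m P) x) = 0"
    unfolding T_minus_def T_plus_def
    by (rule refl_op_A2[OF refl _ _ refl])
      (use ne d in \<open>auto simp: vec_eq_iff refl_nth long_coeff_neg f f' h intro!: long_coeff_triangle\<close>)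
  show "T_minus p q (T_plus q m P) x - T_plus q m (T_minus p q P) x + (T_minus p q (T_plus p m P) x - T_plus p m (T_minus p q P) x)
      + (T_plus p m (T_plus q m P) x - T_plus q m (T_plus p m P) x) = 0"
    unfolding T_minus_def T_plus_def
    by (rule refl_op_A2[OF refl _ _ refl])
      (use ne d in \<open>auto simp: vec_eq_iff refl_nth long_coeff_neg f f' h intro!: long_coeff_triangle\<close>)
  show "T_plus p m (T_minus q m P) x - T_minus q m (T_plus p m P) x + (T_plus p m (T_plus p q P) x - T_plus p q (T_plus p m P) x)
      + (T_plus p q (T_minus q m P) x - T_minus q m (T_plus p q P) x) = 0"
    unfolding T_minus_def T_plus_def
    by (rule refl_op_A2[OF refl _ _ refl])
      (use ne d in \<open>auto simp: vec_eq_iff refl_nth long_coeff_neg f f' h intro!: long_coeff_triangle t\<close>)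
  show "T_minus p m (T_plus q m P) x - T_plus q m (T_minus p m P) x + (T_minus p m (T_plus p q P) x - T_plus p q (T_minus p m P) x)
      + (T_plus p q (T_plus q m P) x - T_plus q m (T_plus p q P) x) = 0"
    unfolding T_minus_def T_plus_def
    by (rule refl_op_A2[OF refl _ _ refl])
      (use ne d in \<open>auto simp: vec_eq_iff refl_nth long_coeff_neg f f' h intro!: long_coeff_triangle t'\<close>)
qed

text \<open>For r = 2 this is the part of the commutator of the two reflection parts that is linear
  in a: the commutator of \<open>T_minus\<close> + \<open>T_plus\<close> with the short operator of
  l, plus the commutator of the short operator of j with \<open>T_plus\<close> -
  \<open>T_minus\<close>.\<close>

lemma refl_op_BC2:
  fixes x :: "real ^ 'n::finite"
  assumes "reg x" "j \<noteq> l"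
  shows "T_short b \<iota> j (T_plus j l P) x - T_plus j l (T_short b \<iota> j P) x - (T_short b \<iota> j (T_minus j l P) x - T_minus j l (T_short b \<iota> j P) x)
    + (T_minus j l (T_short b \<iota> l P) x - T_short b \<iota> l (T_minus j l P) x) + (T_plus j l (T_short b \<iota> l P) x - T_short b \<iota> l (T_plus j l P) x) = 0"
proof -
  define X Y where "X = complex_of_real (x $ j)" "Y = complex_of_real (x $ l)"
  have ne: "X \<noteq> Y" "X \<noteq> - Y" "Y \<noteq> - X" "X \<noteq> 0" "Y \<noteq> 0"
    using assms reg_distinct[of x] reg_distinct_neg[of x] reg_nonzero[of x]
    by (auto simp: X_Y_def simp flip: of_real_minus)
  have e: "swap j l (neg_coord j x) = neg_coord l (swap j l x)"
    "swap j l (neg_coord l x) = neg_coord j (swap j l x)"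
    "neg_swap j l (neg_coord j x) = neg_coord j (swap j l x)"
    "neg_swap j l (neg_coord l x) = neg_coord l (swap j l x)"
    "neg_coord j (neg_swap j l x) = neg_coord l (swap j l x)"
    "neg_coord l (neg_swap j l x) = neg_coord j (swap j l x)"
    using assms(2) by (auto simp: vec_eq_iff refl_nth)
  have c: "long_coeff (- X) Y = 1 - long_coeff X (- Y)" "long_coeff (- X) (- Y) = 1 - long_coeff X Y" 
    using long_coeff_flip[of X "- Y"] long_coeff_flip[of X Y] long_coeff_neg[of X Y] long_coeff_neg[of X "- Y"] ne by auto
  have k: "short_coeff b \<iota> X * (long_coeff X Y + long_coeff X (- Y) - 1) + short_coeff b \<iota> Y * (long_coeff X (- Y) - long_coeff X Y)
    = (2 * \<iota> + 2 * b) * long_coeff X (- Y)" 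
    using ne by (intro short_coeff_long_coeff)
  show ?thesis
    unfolding T_minus_def T_plus_def T_short_def refl_op_def e
    apply (simp add: refl_nth c ne short_coeff_neg assms(2) assms(2)[symmetric] flip: X_Y_def)
    using k apply algebra
    done
qed

text \<open>The case of orthogonal roots: the reflections commute and each preserves the coefficient
  belonging to the other.\<close>

lemma refl_op_commute:
  assumes "r1 (r2 x) = r2 (r1 x)" "c1 (r2 x) = c1 x" "c2 (r1 x) = c2 x"
  shows "refl_op c1 r1 (refl_op c2 r2 P) x = refl_op c2 r2 (refl_op c1 r1 P) x"
  unfolding refl_op_def assms by algebra

lemma T_short_T_short_commute: "i \<noteq> j \<Longrightarrow> T_short b \<iota> i (T_short b \<iota> j P) x = T_short b \<iota> j (T_short b \<iota> i P) x"
  unfolding T_short_def by (rule refl_op_commute) (auto simp: vec_eq_iff refl_nth)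

lemma T_short_T_minus_commute:
    "i \<noteq> j \<Longrightarrow> i \<noteq> k \<Longrightarrow> T_short b \<iota> i (T_minus j k P) x = T_minus j k (T_short b \<iota> i P) x"
  and T_short_T_plus_commute:
    "i \<noteq> j \<Longrightarrow> i \<noteq> k \<Longrightarrow> T_short b \<iota> i (T_plus j k P) x = T_plus j k (T_short b \<iota> i P) x"
  unfolding T_short_def T_minus_def T_plus_def by (rule refl_op_commute; auto simp: vec_eq_iff refl_nth)+

lemma T_disjoint_commute:
  assumes "{i, j} \<inter> {k, m} = {}"
  shows "T_minus i j (T_minus k m P) x = T_minus k m (T_minus i j P) x"
    "T_minus i j (T_plus k m P) x = T_plus k m (T_minus i j P) x"
    "T_plus i j (T_plus k m P) x = T_plus k m (T_plus i j P) x"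
  unfolding T_minus_def T_plus_def using assms by (intro refl_op_commute; auto simp: vec_eq_iff refl_nth)+

lemma T_minus_T_plus_commute: "T_minus i j (T_plus i j P) x = T_plus i j (T_minus i j P) x"
  unfolding T_minus_def T_plus_def
  by (rule refl_op_commute) (auto simp: vec_eq_iff refl_nth long_coeff_neg long_coeff_neg[of "- of_real (x $ i)" "of_real (x $ j)", simplified])

lemma T_plus_sym: "T_plus i j = T_plus j i"
proof -
  have "long_coeff u (- v) = long_coeff v (- u)" for u v using long_coeff_neg[of "- u" v] by simp
  moreover have "neg_swap i j = neg_swap j i" by (auto simp: fun_eq_iff vec_eq_iff refl_nth)
  ultimately show ?thesis by (auto simp: T_plus_def)
qed

text \<open>For \<open>i < j\<close> the operator \<open>D\<^sub>j\<close> contains the reflection operator of \<open>\<xi>\<^sub>i\<^sup>* - \<xi>\<^sub>j\<^sup>*\<close> with a minus sign.\<close>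

definition T_pair :: "'n::{finite,linorder} \<Rightarrow> 'n \<Rightarrow> (real ^ 'n::{finite,linorder} \<Rightarrow> complex) \<Rightarrow> real ^ 'n::{finite,linorder} \<Rightarrow> complex"
  where "T_pair j k P x = (if j < k then T_minus j k P x else - T_minus k j P x) + T_plus j k P x"

definition linear_op :: "(('a \<Rightarrow> complex) \<Rightarrow> 'a \<Rightarrow> complex) \<Rightarrow> bool"
  where "linear_op T \<longleftrightarrow> (\<forall>P Q. T (\<lambda>x. P x + Q x) = (\<lambda>x. T P x + T Q x)) \<and>
    (\<forall>c P. T (\<lambda>x. c * P x) = (\<lambda>x. c * T P x))"

lemma linear_op_add: "linear_op T \<Longrightarrow> T (\<lambda>x. P x + Q x) = (\<lambda>x. T P x + T Q x)"
  and linear_op_cmult: "linear_op T \<Longrightarrow> T (\<lambda>x. c * P x) = (\<lambda>x. c * T P x)"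
  by (simp_all add: linear_op_def)

lemma linear_op_uminus: "linear_op T \<Longrightarrow> T (\<lambda>x. - P x) = (\<lambda>x. - T P x)"
  using linear_op_cmult[of T "-1"] by simp

lemma linear_op_diff: "linear_op T \<Longrightarrow> T (\<lambda>x. P x - Q x) = (\<lambda>x. T P x - T Q x)"
  using linear_op_add[of T P "\<lambda>x. - Q x"] by (simp add: linear_op_uminus)

lemma linear_op_sum: "linear_op T \<Longrightarrow> T (\<lambda>x. \<Sum>k\<in>S. P k x) = (\<lambda>x. \<Sum>k\<in>S. T (P k) x)"
proof (induction S rule: infinite_finite_induct)
  case (insert k S)
  then show ?case using linear_op_add[of T "P k" "\<lambda>x. \<Sum>k\<in>S. P k x"] by simp
qed (use linear_op_cmult[of T 0] in simp_all)

lemma linear_op_refl_op: "linear_op (refl_op c w)"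
  by (simp add: linear_op_def refl_op_def fun_eq_iff algebra_simps)

lemma linear_op_T: "linear_op (T_minus i j)" "linear_op (T_plus i j)" "linear_op (T_short b \<iota> j)"
  by (simp_all add: T_minus_def T_plus_def T_short_def linear_op_refl_op)

lemma linear_op_T_pair: "linear_op (T_pair j k)"
  using linear_op_T(1)[of j k] linear_op_T(1)[of k j] linear_op_T(2)[of j k] by (auto simp: linear_op_def T_pair_def fun_eq_iff algebra_simps)

lemmas linear_op_T_simps = linear_op_T[THEN linear_op_add] linear_op_T[THEN linear_op_diff] linear_op_T[THEN linear_op_uminus]
  linear_op_T[THEN linear_op_cmult] linear_op_T[THEN linear_op_sum]
lemmas linear_op_T_pair_simps = linear_op_T_pair[THEN linear_op_add] linear_op_T_pair[THEN linear_op_cmult] linear_op_T_pair[THEN linear_op_sum]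

lemma T_pair_disjoint_commute:
  assumes "{i, j} \<inter> {k, m} = {}"
  shows "T_pair i j (T_pair k m P) x = T_pair k m (T_pair i j P) x"
proof -
  have s: "{j, i} \<inter> {k, m} = {}" "{i, j} \<inter> {m, k} = {}" "{j, i} \<inter> {m, k} = {}"
    "{k, m} \<inter> {i, j} = {}" "{k, m} \<inter> {j, i} = {}" "{m, k} \<inter> {i, j} = {}" "{m, k} \<inter> {j, i} = {}"
    using assms by auto
  note o = assms s(1-3)
  note t = o[THEN T_disjoint_commute(1)] o[THEN T_disjoint_commute(2)]
    o[THEN T_disjoint_commute(3)] s(4-7)[THEN T_disjoint_commute(2), symmetric]
  show ?thesis
    by (cases "i < j"; cases "k < m") (simp_all add: T_pair_def[abs_def] linear_op_T_simps t)
qed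

lemma T_short_T_pair_commute: "i \<noteq> j \<Longrightarrow> i \<noteq> k \<Longrightarrow> T_short b \<iota> i (T_pair j k P) x = T_pair j k (T_short b \<iota> i P) x"
  by (simp add: T_pair_def[abs_def] linear_op_T_simps T_short_T_minus_commute T_short_T_plus_commute)

text \<open>With A, B the operators of the orthogonal roots xi_j - xi_l and xi_j + xi_l, the two
  sides are (A + B)(B - A) and (B - A)(A + B).\<close>

lemma T_pair_opposite_commute:
  assumes "j < l"
  shows "T_pair j l (T_pair l j P) x = T_pair l j (T_pair j l P) x"
proof -
  have "\<not> l < j" using assms by simp
  with assms show ?thesis
    by (simp add: T_pair_def[abs_def] linear_op_T_simps T_minus_T_plus_commute T_plus_sym[of l j])
qed

lemma T_pair_T_short_pair:
  assumes "reg x" "j < l"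
  shows "T_pair j l (T_short b \<iota> l P) x - T_short b \<iota> l (T_pair j l P) x + (T_short b \<iota> j (T_pair l j P) x - T_pair l j (T_short b \<iota> j P) x) = 0"
proof -
  have n: "\<not> l < j" using assms by simp
  show ?thesis
    unfolding T_pair_def[abs_def] T_plus_sym[of l j] if_P[OF assms(2)] if_not_P[OF n] linear_op_T_simps
    using refl_op_BC2[OF assms(1) less_imp_neq[OF assms(2)], of b \<iota> P] by algebra
qed

text \<open>The signs in \<open>T_pair\<close> depend on the order of the indices, hence the three
  positions of k. In each, the twelve commutators obtained by expansion form a signed combination of
  the four A_2 relations for the three indices in increasing order.\<close>

lemma T_pair_triple:
  assumes "reg x" "j < l" "k \<noteq> j" "k \<noteq> l"
  shows "T_pair j k (T_pair l k P) x - T_pair l k (T_pair j k P) x + (T_pair j l (T_pair l k P) x - T_pair l k (T_pair j l P) x)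
    + (T_pair j k (T_pair l j P) x - T_pair l j (T_pair j k P) x) = 0"
proof -
  consider "k < j" | "j < k" "k < l" | "l < k" using assms by (metis linorder_neqE)
  then show ?thesis
  proof cases
    case 1
    with assms have n: "\<not> j < k" "\<not> l < k" "\<not> l < j" by auto
    show ?thesis
      unfolding T_pair_def[abs_def] if_P[OF assms(2)]
        T_plus_sym[of j k] T_plus_sym[of l k] T_plus_sym[of l j]
        n[THEN if_not_P] linear_op_T_simps
      using T_minus_T_plus_A2[OF assms(1) assms(3,4) less_imp_neq[OF assms(2)], of P] by algebra
  next
    case 2
    with assms have n: "\<not> l < k" "\<not> l < j" by auto
    show ?thesis
      unfolding T_pair_def[abs_def] if_P[OF assms(2)] if_P[OF 2(1)]
        T_plus_sym[of k j] T_plus_sym[of l k] T_plus_sym[of l j]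
        n[THEN if_not_P] linear_op_T_simps
      using T_minus_T_plus_A2[OF assms(1) assms(3)[symmetric] less_imp_neq[OF assms(2)] assms(4), of P] by algebra
  next
    case 3
    with assms have n: "\<not> l < j" by auto
    show ?thesis
      unfolding T_pair_def[abs_def] if_P[OF assms(2)] if_P[OF 3] if_P[OF less_trans[OF assms(2) 3]]
        T_plus_sym[of k j] T_plus_sym[of k l] T_plus_sym[of l j]
        n[THEN if_not_P] linear_op_T_simps
      using T_minus_T_plus_A2[OF assms(1) less_imp_neq[OF assms(2)] assms(3,4)[symmetric], of P] by algebra
  qed
qed

section \<open>Commutation of the full reflection parts\<close>

definition T_total :: "complex \<Rightarrow> complex \<Rightarrow> complex \<Rightarrow> 'n::{finite,linorder} \<Rightarrow>
    (real ^ 'n::{finite,linorder} \<Rightarrow> complex) \<Rightarrow> real ^ 'n::{finite,linorder} \<Rightarrow> complex"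
  where "T_total a b \<iota> j P x = a * (\<Sum>k\<in>UNIV - {j}. T_pair j k P x) + T_short b \<iota> j P x"

lemma linear_op_T_total: "linear_op (T_total a b \<iota> j)"
  unfolding linear_op_def T_total_def
  by (simp add: linear_op_T_pair_simps linear_op_T_simps sum.distrib sum_distrib_left[symmetric]
      algebra_simps fun_eq_iff)

text \<open>The commutator is sorted by the indices involved. Terms with four distinct indices
  vanish by orthogonality, those with j, l and one further k by \<open>T_pair_triple\<close> for
  that k, and those with j and l alone by the relations for two indices.\<close>

lemma T_total_commute:
  assumes "reg x" "j < l"
  shows "T_total a b \<iota> j (T_total a b \<iota> l P) x = T_total a b \<iota> l (T_total a b \<iota> j P) x"
proof -
  define S where "S = UNIV - {j, l}"
  have S: "finite S" "UNIV - {j} = insert l S" "UNIV - {l} = insert j S" "j \<notin> S" "l \<notin> S"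
    using assms(2) by (auto simp: S_def)
  have e: "T_total a b \<iota> j Q = (\<lambda>x. a * (T_pair j l Q x + (\<Sum>k\<in>S. T_pair j k Q x)) + T_short b \<iota> j Q x)"
    "T_total a b \<iota> l Q = (\<lambda>x. a * (T_pair l j Q x + (\<Sum>k\<in>S. T_pair l k Q x)) + T_short b \<iota> l Q x)" for Q
    by (simp_all add: T_total_def fun_eq_iff S)
  \<comment> \<open>For m different from k the index pairs {j, k} and {l, m} are disjoint, so only
    the diagonal m = k survives.\<close>
  have dd: "(\<Sum>k\<in>S. \<Sum>m\<in>S. T_pair j k (T_pair l m P) x) - (\<Sum>k\<in>S. \<Sum>m\<in>S. T_pair l k (T_pair j m P) x)
    = (\<Sum>k\<in>S. T_pair j k (T_pair l k P) x - T_pair l k (T_pair j k P) x)"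
  proof -
    have "(\<Sum>k\<in>S. \<Sum>m\<in>S. T_pair j k (T_pair l m P) x) - (\<Sum>k\<in>S. \<Sum>m\<in>S. T_pair l k (T_pair j m P) x)
      = (\<Sum>k\<in>S. \<Sum>m\<in>S. T_pair j k (T_pair l m P) x - T_pair l m (T_pair j k P) x)"
      by (subst (2) sum.swap) (simp add: sum_subtractf)
    also have "\<dots> = (\<Sum>k\<in>S. \<Sum>m\<in>S. if m = k then T_pair j k (T_pair l k P) x - T_pair l k (T_pair j k P) x else 0)"
    proof (intro sum.cong refl)
      fix k m assume "k \<in> S" "m \<in> S"
      then show "T_pair j k (T_pair l m P) x - T_pair l m (T_pair j k P) x
          = (if m = k then T_pair j k (T_pair l k P) x - T_pair l k (T_pair j k P) x else 0)"
        using T_pair_disjoint_commute[of j k l m P x] assms(2) S by auto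
    qed
    finally show ?thesis using S(1) by simp
  qed
  have "(\<Sum>k\<in>S. T_pair j k (T_pair l k P) x - T_pair l k (T_pair j k P) x + (T_pair j l (T_pair l k P) x - T_pair l k (T_pair j l P) x)
    + (T_pair j k (T_pair l j P) x - T_pair l j (T_pair j k P) x)) = 0"
    using T_pair_triple[OF assms] S by (intro sum.neutral) blast
  then have tr: "(\<Sum>k\<in>S. T_pair j k (T_pair l k P) x - T_pair l k (T_pair j k P) x)
    + ((\<Sum>k\<in>S. T_pair j l (T_pair l k P) x) - (\<Sum>k\<in>S. T_pair l k (T_pair j l P) x))
    + ((\<Sum>k\<in>S. T_pair j k (T_pair l j P) x) - (\<Sum>k\<in>S. T_pair l j (T_pair j k P) x)) = 0"
    by (simp add: sum.distrib sum_subtractf)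
  have bb: "(\<Sum>k\<in>S. T_short b \<iota> j (T_pair l k P) x) = (\<Sum>k\<in>S. T_pair l k (T_short b \<iota> j P) x)"
    "(\<Sum>k\<in>S. T_short b \<iota> l (T_pair j k P) x) = (\<Sum>k\<in>S. T_pair j k (T_short b \<iota> l P) x)"
    using S assms(2) by (auto intro!: sum.cong T_short_T_pair_commute)
  have dd': "(\<Sum>k\<in>S. \<Sum>m\<in>S. T_pair j k (T_pair l m P) x) = (\<Sum>k\<in>S. \<Sum>m\<in>S. T_pair l k (T_pair j m P) x)
    - ((\<Sum>k\<in>S. T_pair j l (T_pair l k P) x) - (\<Sum>k\<in>S. T_pair l k (T_pair j l P) x))
    - ((\<Sum>k\<in>S. T_pair j k (T_pair l j P) x) - (\<Sum>k\<in>S. T_pair l j (T_pair j k P) x))"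
  proof -
    have "x = y - u - v" if "x - y = d" "d + u + v = 0" for x y d u v :: complex
    proof -
      have "x - (y - u - v) = (x - y) + u + v" by simp
      then show ?thesis unfolding that by (simp only: right_minus_eq)
    qed
    from this[OF dd tr] show ?thesis .
  qed
  have pair: "T_pair j l (T_short b \<iota> l P) x = T_short b \<iota> l (T_pair j l P) x - (T_short b \<iota> j (T_pair l j P) x - T_pair l j (T_short b \<iota> j P) x)"
    using T_pair_T_short_pair[OF assms, of b \<iota> P] by algebra
  show ?thesis
    unfolding e linear_op_T_pair_simps linear_op_T_simps sum.distrib sum_distrib_left[symmetric] bb dd' pair
      T_pair_opposite_commute[OF assms(2)] T_short_T_short_commute[OF less_imp_neq[OF assms(2)]]
    by (simp add: algebra_simps)
qed

subsection \<open>Commutation of the Cherednik operators on polynomials\<close>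

text \<open>\<open>refl_op\<close> of a polynomial is not a polynomial as a total function: where
  the denominator vanishes, division by zero gives a wrong value. This class ignores such points and
  is stable under all operators used.\<close>

definition regpoly :: "(real ^ 'n::finite \<Rightarrow> complex) \<Rightarrow> bool"
  where "regpoly G \<longleftrightarrow> (\<exists>Q. polyf Q \<and> (\<forall>x. reg x \<longrightarrow> G x = Q x))"

lemma regpolyI: "polyf Q \<Longrightarrow> (\<And>x. reg x \<Longrightarrow> G x = Q x) \<Longrightarrow> regpoly G"
  and regpolyE: "regpoly G \<Longrightarrow> (\<And>Q. polyf Q \<Longrightarrow> (\<And>x. reg x \<Longrightarrow> G x = Q x) \<Longrightarrow> thesis) \<Longrightarrow> thesis"
  by (auto simp: regpoly_def)

lemma polyf_regpoly: "polyf P \<Longrightarrow> regpoly P"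
  by (auto simp: regpoly_def)

lemma regpoly_add: "regpoly F \<Longrightarrow> regpoly G \<Longrightarrow> regpoly (\<lambda>x. F x + G x)"
  by (elim regpolyE, rule regpolyI[OF polyf_add]) auto

lemma regpoly_mult: "regpoly F \<Longrightarrow> regpoly G \<Longrightarrow> regpoly (\<lambda>x. F x * G x)"
  by (elim regpolyE, rule regpolyI[OF polyf_mult]) auto

lemma regpoly_cmult: "regpoly G \<Longrightarrow> regpoly (\<lambda>x. c * G x)"
  by (rule regpoly_mult[OF polyf_regpoly[OF polyf_const]])

lemma regpoly_uminus: "regpoly G \<Longrightarrow> regpoly (\<lambda>x. - G x)"
  using regpoly_cmult[of G "-1"] by simp

lemma regpoly_diff: "regpoly F \<Longrightarrow> regpoly G \<Longrightarrow> regpoly (\<lambda>x. F x - G x)"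
  using regpoly_add[of F "\<lambda>x. - G x"] by (simp add: regpoly_uminus)

lemma regpoly_sum:
  assumes "\<And>k. k \<in> S \<Longrightarrow> regpoly (G k)"
  shows "regpoly (\<lambda>x. \<Sum>k\<in>S. G k x)"
  using assms
proof (induction S rule: infinite_finite_induct)
  case (insert k S)
  then show ?case using regpoly_add[of "G k" "\<lambda>x. \<Sum>k\<in>S. G k x"] by simp
qed (simp_all add: polyf_regpoly polyf_const)

lemma regpoly_dx: "regpoly G \<Longrightarrow> regpoly (dx j G)"
  by (elim regpolyE, rule regpolyI[OF polyf_dx[of _ j]], assumption) (rule dx_cong_reg)

lemma dx_add_reg:
  assumes "regpoly F" "regpoly G" "reg x"
  shows "dx j (\<lambda>x. F x + G x) x = dx j F x + dx j G x"
proof -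
  obtain P Q where P: "polyf P" "\<And>x. reg x \<Longrightarrow> F x = P x" and Q: "polyf Q" "\<And>x. reg x \<Longrightarrow> G x = Q x"
    using assms by (auto elim!: regpolyE)
  have c: "dx j F x = dx j P x" "dx j G x = dx j Q x"
    by (rule dx_cong_reg[OF assms(3)]; simp add: P Q)+
  have "dx j (\<lambda>x. F x + G x) x = dx j (\<lambda>x. P x + Q x) x"
    by (intro dx_cong_reg assms) (simp add: P Q)
  also have "\<dots> = dx j F x + dx j G x"
    by (simp add: dx_add P(1) Q(1) c)
  finally show ?thesis .
qed

lemma dx_mult_reg:
  assumes "regpoly F" "regpoly G" "reg x"
  shows "dx j (\<lambda>x. F x * G x) x = dx j F x * G x + F x * dx j G x"
proof -
  obtain P Q where P: "polyf P" "\<And>x. reg x \<Longrightarrow> F x = P x" and Q: "polyf Q" "\<And>x. reg x \<Longrightarrow> G x = Q x"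
    using assms by (auto elim!: regpolyE)
  have c: "dx j F x = dx j P x" "dx j G x = dx j Q x"
    by (rule dx_cong_reg[OF assms(3)]; simp add: P Q)+
  have "dx j (\<lambda>x. F x * G x) x = dx j (\<lambda>x. P x * Q x) x"
    by (intro dx_cong_reg assms) (simp add: P Q)
  also have "\<dots> = dx j F x * G x + F x * dx j G x"
    using assms(3) by (simp add: dx_mult P Q c)
  finally show ?thesis .
qed

lemma dx_cmult_reg: "regpoly F \<Longrightarrow> reg x \<Longrightarrow> dx j (\<lambda>x. c * F x) x = c * dx j F x"
  using dx_mult_reg[where F = "\<lambda>x. c" and G = F] by (simp add: polyf_regpoly polyf_const dx_const)

lemma dx_sum_reg:
  assumes "\<And>k. k \<in> S \<Longrightarrow> regpoly (G k)" "reg x"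
  shows "dx j (\<lambda>x. \<Sum>k\<in>S. G k x) x = (\<Sum>k\<in>S. dx j (G k) x)"
  using assms(1)
proof (induction S rule: infinite_finite_induct)
  case (insert k S)
  then show ?case
    using dx_add_reg[OF _ _ assms(2), where F = "G k" and G = "\<lambda>x. \<Sum>k\<in>S. G k x"] by (simp add: regpoly_sum)
qed (simp_all add: dx_const)

text \<open>The coefficient \<open>c\<close> is the rational function \<open>K / l\<close>, where \<open>l\<close> divides \<open>P - P \<circ> w\<close> for every polynomial \<open>P\<close>.\<close>

definition refl_data :: "(real ^ 'n \<Rightarrow> complex) \<Rightarrow> (real ^ 'n::finite \<Rightarrow> real ^ 'n) \<Rightarrow>
    (real ^ 'n \<Rightarrow> real) \<Rightarrow> (real ^ 'n \<Rightarrow> complex) \<Rightarrow> bool"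
  where "refl_data c w l K \<longleftrightarrow>
    (\<forall>k. \<exists>d. \<forall>x. x $ k - w x $ k = d * l x) \<and> (\<forall>k. polyf (\<lambda>x. complex_of_real (w x $ k))) \<and>
    polyf (\<lambda>x. complex_of_real (l x)) \<and> polyf K \<and>
    (\<forall>x. reg x \<longrightarrow> reg (w x) \<and> l x \<noteq> 0 \<and> c x * of_real (l x) = K x)"

lemma polyf_divide_const: "polyf P \<Longrightarrow> polyf (\<lambda>x. P x / c)"
  using polyf_mult[OF polyf_const, of P "inverse c"] by (simp add: field_simps)

lemma polyf_signed_coord: "polyf (\<lambda>x. complex_of_real (if p then x $ i else if q then x $ j else x $ k))"
  "polyf (\<lambda>x. complex_of_real (if p then - x $ i else if q then - x $ j else x $ k))"
  "polyf (\<lambda>x. complex_of_real (if p then - x $ i else x $ k))"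
  by (cases p; cases q; simp add: polyf_intros)+

lemma refl_data_T_minus:
  assumes "i \<noteq> j"
  shows "refl_data (\<lambda>x. long_coeff (of_real (x $ i)) (of_real (x $ j))) (swap i j) (\<lambda>x. x $ i - x $ j)
    (\<lambda>x. 1 / 2 * ((1 + of_real (x $ i)) * (1 - of_real (x $ j))))"
  unfolding refl_data_def
proof (intro conjI allI impI)
  fix k
  show "\<exists>d. \<forall>x::real ^ 'a. x $ k - swap i j x $ k = d * (x $ i - x $ j)"
    by (rule exI[of _ "if k = i then 1 else if k = j then -1 else 0"]) (simp add: refl_nth)
next
  fix x :: "real ^ 'a" assume "reg x"
  then have "complex_of_real (x $ i) \<noteq> of_real (x $ j)" using reg_distinct assms by auto
  from long_coeff_eq[OF this]
  show "long_coeff (of_real (x $ i)) (of_real (x $ j)) * of_real (x $ i - x $ j)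
      = 1 / 2 * ((1 + of_real (x $ i)) * (1 - of_real (x $ j)))"
    by (simp add: field_simps)
qed (use assms in \<open>simp_all add: refl_nth polyf_signed_coord polyf_intros polyf_divide_const reg_refl reg_distinct\<close>)

lemma refl_data_T_plus:
  assumes "i \<noteq> j"
  shows "refl_data (\<lambda>x. long_coeff (of_real (x $ i)) (- of_real (x $ j))) (neg_swap i j) (\<lambda>x. x $ i + x $ j)
    (\<lambda>x. 1 / 2 * ((1 + of_real (x $ i)) * (1 + of_real (x $ j))))"
  unfolding refl_data_def
proof (intro conjI allI impI)
  fix k
  show "\<exists>d. \<forall>x::real ^ 'a. x $ k - neg_swap i j x $ k = d * (x $ i + x $ j)"
    by (rule exI[of _ "if k = i then 1 else if k = j then 1 else 0"]) (simp add: refl_nth)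
next
  fix x :: "real ^ 'a" assume "reg x"
  then have "complex_of_real (x $ i) \<noteq> - of_real (x $ j)"
    using reg_distinct_neg[OF _ assms, of x] by (simp flip: of_real_minus)
  from long_coeff_eq[OF this]
  show "long_coeff (of_real (x $ i)) (- of_real (x $ j)) * of_real (x $ i + x $ j)
      = 1 / 2 * ((1 + of_real (x $ i)) * (1 + of_real (x $ j)))"
    by (simp add: field_simps)
qed (use assms in \<open>simp_all add: refl_nth polyf_signed_coord polyf_intros polyf_divide_const reg_refl reg_distinct_add\<close>)

lemma refl_data_T_short:
  "refl_data (\<lambda>x. short_coeff b \<iota> (of_real (x $ j))) (neg_coord j) (\<lambda>x. x $ j)
    (\<lambda>x. \<iota> / 2 * (1 + of_real (x $ j))\<^sup>2 + b * (of_real (x $ j) * (1 + of_real (x $ j))))"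
  unfolding refl_data_def
proof (intro conjI allI impI)
  fix k
  show "\<exists>d. \<forall>x::real ^ 'a. x $ k - neg_coord j x $ k = d * x $ j"
    by (rule exI[of _ "if k = j then 2 else 0"]) (simp add: refl_nth)
next
  fix x :: "real ^ 'a" assume "reg x"
  then have "complex_of_real (x $ j) \<noteq> 0" using reg_nonzero by simp
  then show "short_coeff b \<iota> (of_real (x $ j)) * of_real (x $ j)
      = \<iota> / 2 * (1 + of_real (x $ j))\<^sup>2 + b * (of_real (x $ j) * (1 + of_real (x $ j)))"
    by (simp add: short_coeff_def field_simps)
next
  fix k
  show "polyf (\<lambda>x. complex_of_real (neg_coord j x $ k))"
    by (cases "k = j") (simp_all add: refl_nth polyf_intros)
next
  show "polyf (\<lambda>x. \<iota> / 2 * (1 + of_real (x $ j))\<^sup>2 + b * (of_real (x $ j) * (1 + of_real (x $ j))))"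
    by (intro polyf_intros)
qed (simp_all add: polyf_intros reg_refl reg_nonzero)

text \<open>The last conclusion holds at every point, including the zeros of \<open>l\<close>. It is
  the form that can be differentiated, and that identifies the quotient in t at points on other
  hyperplanes.\<close>

lemma refl_op_polyf_extension:
  assumes "refl_data c w l K" "polyf P"
  obtains Q where "polyf Q" "\<And>x. reg x \<Longrightarrow> refl_op c w P x = Q x"
    "\<And>x. of_real (l x) * Q x = K x * (P x - P (w x))"
proof -
  obtain Q where Q: "polyf Q" "\<And>x. P x - P (w x) = complex_of_real (l x) * Q x"
    using polyf_quotient[OF assms(2), of w l] assms(1) unfolding refl_data_def by auto
  have "refl_op c w P x = K x * Q x" if "reg x" for x
  proof -
    have "K x = c x * of_real (l x)" using assms(1) that by (simp add: refl_data_def)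
    then show ?thesis by (simp add: refl_op_def Q(2))
  qed
  moreover have "polyf (\<lambda>x. K x * Q x)" using assms(1) Q(1) by (auto simp: refl_data_def polyf_intros)
  ultimately show ?thesis using that[of "\<lambda>x. K x * Q x"] Q(2) by (simp add: algebra_simps)
qed

lemma refl_op_cong_reg:
  assumes "\<And>x. reg x \<Longrightarrow> P x = Q x" "reg x" "reg (w x)"
  shows "refl_op c w P x = refl_op c w Q x"
  using assms by (simp add: refl_op_def)

lemma regpoly_refl_op:
  assumes "refl_data c w l K" "regpoly G"
  shows "regpoly (refl_op c w G)"
proof -
  obtain P where P: "polyf P" "\<And>x. reg x \<Longrightarrow> G x = P x" using assms(2) by (auto elim: regpolyE)
  obtain Q where Q: "polyf Q" "\<And>x. reg x \<Longrightarrow> refl_op c w P x = Q x"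
    using refl_op_polyf_extension[OF assms(1) P(1)] by metis
  show ?thesis
    using Q refl_op_cong_reg[of G P _ w c] P(2) assms(1) by (intro regpolyI[of Q]) (auto simp: refl_data_def)
qed

text \<open>The rational coefficient \<open>c\<close> is never differentiated: the derivation is applied to the polynomial identity
  \<open>l * Q = K * (P - P \<circ> w)\<close>, in which \<open>Q\<close> is the polynomial extending \<open>refl_op c w P\<close>.\<close>

lemma dx_refl_op_commute:
  fixes s :: complex and i j :: "'n::finite"
  defines "D \<equiv> \<lambda>P x. dx i P x + s * dx j P x"
  assumes h: "refl_data c w l K"
    and Dw: "\<And>k y. D (\<lambda>x. of_real (w x $ k)) y = D (\<lambda>x. of_real (x $ k)) (w y)"
    and DK: "\<And>y. K y * D (\<lambda>x. of_real (l x)) y = D K y * of_real (l y)"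
    and P: "polyf P" and x: "reg x"
  shows "D (refl_op c w P) x = refl_op c w (D P) x"
proof -
  have w: "\<And>k. polyf (\<lambda>x. complex_of_real (w x $ k))" and l: "polyf (\<lambda>x. complex_of_real (l x))"
    and K: "polyf K" and r: "reg (w x)" "l x \<noteq> 0" "c x * of_real (l x) = K x"
    using h x by (auto simp: refl_data_def)
  have Dmult: "D (\<lambda>x. F x * G x) y = D F y * G y + F y * D G y" if "polyf F" "polyf G" for F G y
    using that by (simp add: D_def dx_mult algebra_simps)
  have Dcomp: "D (\<lambda>x. F (w x)) y = D F (w y)" if "polyf F" for F y
    using that
  proof induction
    case (polyf_const c)
    show ?case by (simp add: D_def dx_const)
  next
    case (polyf_coord k)
    show ?case by (rule Dw)
  next
    case (polyf_add F G)
    then show ?case using polyf_compose[OF _ w]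
      by (simp add: D_def dx_add) (simp add: algebra_simps)
  next
    case (polyf_mult F G)
    then show ?case using polyf_compose[OF _ w] by (simp add: Dmult)
  qed
  obtain Q where Q: "polyf Q" "\<And>x. reg x \<Longrightarrow> refl_op c w P x = Q x"
    "\<And>x. of_real (l x) * Q x = K x * (P x - P (w x))"
    using refl_op_polyf_extension[OF h P] by metis
  have "D (\<lambda>x. of_real (l x) * Q x) x = D (\<lambda>x. K x * (P x - P (w x))) x"
    unfolding Q(3) ..
  moreover have "D (\<lambda>x. P x - P (w x)) x = D P x - D P (w x)"
    using Dcomp[OF P, of x] P polyf_compose[OF P w] by (simp add: D_def dx_diff algebra_simps)
  ultimately have e: "D (\<lambda>x. of_real (l x)) x * Q x + of_real (l x) * D Q x
      = D K x * (P x - P (w x)) + K x * (D P x - D P (w x))"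
    by (simp add: Dmult l Q(1) K polyf_diff P polyf_compose[OF P w])
  \<comment> \<open>\<open>DK\<close> says that D annihilates the coefficient K / l, with
    denominators cleared. One more factor \<open>l\<close> makes it applicable, and the terms
    containing D l and D K cancel.\<close>
  have "of_real (l x) * of_real (l x) * D Q x = of_real (l x) * (K x * (D P x - D P (w x)))"
    using e Q(3)[of x] DK[of x] by algebra
  then have "of_real (l x) * D Q x = K x * (D P x - D P (w x))" using r(2) by simp
  then have "D Q x = c x * (D P x - D P (w x))" using r(2) unfolding r(3)[symmetric] by simp
  moreover have "D (refl_op c w P) x = D Q x"
    unfolding D_def by (simp only: dx_cong_reg[OF x Q(2)])
  ultimately show ?thesis by (simp add: refl_op_def)
qed

text \<open>The conjugate of d/dt_j by |SH|^\<delta>; the second term is the logarithmic derivative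
  \<delta> coth t_j.\<close>

definition deriv_op :: "complex \<Rightarrow> 'n::finite \<Rightarrow> (real ^ 'n \<Rightarrow> complex) \<Rightarrow> real ^ 'n \<Rightarrow> complex"
  where "deriv_op \<delta> j P x = dx j P x + \<delta> * of_real (x $ j) * P x"

text \<open>A derivation in a direction fixed by the reflection commutes with the reflection
  operator, whose coefficient is constant in that direction. The values used for \<open>s\<close>
  are 1 for \<open>swap\<close>, -1 for \<open>neg_swap\<close>, and 0 (with j = i) for a coordinate
  that the reflection does not move.\<close>

lemma deriv_op_refl_op_commute:
  fixes i j :: "'n::finite" and s :: real
  assumes h: "refl_data c w l K"
    and "\<And>k y. dx i (\<lambda>x. of_real (w x $ k)) y + s * dx j (\<lambda>x. of_real (w x $ k)) y
      = dx i (\<lambda>x. of_real (x $ k)) (w y) + s * dx j (\<lambda>x. of_real (x $ k)) (w y)"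
    and "\<And>y. K y * (dx i (\<lambda>x. of_real (l x)) y + s * dx j (\<lambda>x. of_real (l x)) y)
      = (dx i K y + s * dx j K y) * of_real (l y)"
    and m: "w x $ i + s * w x $ j = x $ i + s * x $ j"
    and P: "polyf P" and x: "reg x"
  shows "deriv_op \<delta> i (refl_op c w P) x + s * deriv_op \<delta> j (refl_op c w P) x = refl_op c w (\<lambda>x. deriv_op \<delta> i P x + s * deriv_op \<delta> j P x) x"
proof -
  have "complex_of_real (w x $ i) + complex_of_real s * complex_of_real (w x $ j)
      = complex_of_real (x $ i) + complex_of_real s * complex_of_real (x $ j)"
    using arg_cong[OF m, of complex_of_real] by simp
  then have "refl_op c w (\<lambda>x. deriv_op \<delta> i P x + s * deriv_op \<delta> j P x) x
    = refl_op c w (\<lambda>x. dx i P x + s * dx j P x) x 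
      + \<delta> * (complex_of_real (x $ i) + complex_of_real s * complex_of_real (x $ j)) * refl_op c w P x"
    unfolding refl_op_def deriv_op_def by algebra
  then show ?thesis
    unfolding dx_refl_op_commute[OF assms(1-3) P x, symmetric] by (simp add: deriv_op_def algebra_simps)
qed

lemma dx_divide_const: "polyf P \<Longrightarrow> dx j (\<lambda>x. P x / c) = (\<lambda>x. dx j P x / c)"
  using dx_cmult[of P j "inverse c"] by (simp add: field_simps)

lemmas dx_poly_simps = polyf_divide_const dx_divide_const dx_add dx_diff dx_mult dx_cmult dx_const dx_coord polyf_intros power2_eq_square

section \<open>Derivations against the individual reflection operators\<close>

lemma deriv_op_T_minus_sum:
  assumes ij: "i \<noteq> j" and "polyf P" "reg x"
  shows "deriv_op \<delta> i (T_minus i j P) x + deriv_op \<delta> j (T_minus i j P) x = T_minus i j (\<lambda>x. deriv_op \<delta> i P x + deriv_op \<delta> j P x) x"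
proof -
  have "deriv_op \<delta> i (T_minus i j P) x + of_real 1 * deriv_op \<delta> j (T_minus i j P) x
      = T_minus i j (\<lambda>x. deriv_op \<delta> i P x + of_real 1 * deriv_op \<delta> j P x) x"
    unfolding T_minus_def
  proof (rule deriv_op_refl_op_commute[OF refl_data_T_minus[OF ij] _ _ _ assms(2,3)])
    fix k y show "dx i (\<lambda>x. of_real (swap i j x $ k)) y + of_real 1 * dx j (\<lambda>x. of_real (swap i j x $ k)) y
      = dx i (\<lambda>x. of_real (x $ k)) (swap i j y) + of_real 1 * dx j (\<lambda>x. of_real (x $ k)) (swap i j y)"
      using ij by (cases "k = i"; cases "k = j") (simp_all add: refl_nth dx_coord)
  qed (use ij in \<open>auto simp: refl_nth dx_poly_simps\<close>, use ij in \<open>simp_all add: field_simps\<close>)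
  then show ?thesis by simp
qed

lemma deriv_op_T_plus_diff:
  assumes ij: "i \<noteq> j" and "polyf P" "reg x"
  shows "deriv_op \<delta> i (T_plus i j P) x - deriv_op \<delta> j (T_plus i j P) x = T_plus i j (\<lambda>x. deriv_op \<delta> i P x - deriv_op \<delta> j P x) x"
proof -
  have "deriv_op \<delta> i (T_plus i j P) x + of_real (- 1) * deriv_op \<delta> j (T_plus i j P) x
      = T_plus i j (\<lambda>x. deriv_op \<delta> i P x + of_real (- 1) * deriv_op \<delta> j P x) x"
    unfolding T_plus_def
  proof (rule deriv_op_refl_op_commute[OF refl_data_T_plus[OF ij] _ _ _ assms(2,3)])
    fix k y show "dx i (\<lambda>x. of_real (neg_swap i j x $ k)) y
        + of_real (- 1) * dx j (\<lambda>x. of_real (neg_swap i j x $ k)) y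
      = dx i (\<lambda>x. of_real (x $ k)) (neg_swap i j y)
        + of_real (- 1) * dx j (\<lambda>x. of_real (x $ k)) (neg_swap i j y)"
      using ij by (cases "k = i"; cases "k = j")
        (simp_all add: refl_nth dx_coord dx_cmult[OF polyf_coord, of _ "-1", simplified])
  qed (use ij in \<open>auto simp: refl_nth dx_poly_simps\<close>, use ij in \<open>simp_all add: field_simps\<close>)
  then show ?thesis by simp
qed

lemma deriv_op_T_minus_commute:
  assumes ne: "l \<noteq> m" "i \<noteq> l" "i \<noteq> m" and "polyf P" "reg x"
  shows "deriv_op \<delta> i (T_minus l m P) x = T_minus l m (deriv_op \<delta> i P) x"
proof -
  have "deriv_op \<delta> i (T_minus l m P) x + of_real 0 * deriv_op \<delta> i (T_minus l m P) x
      = T_minus l m (\<lambda>x. deriv_op \<delta> i P x + of_real 0 * deriv_op \<delta> i P x) x"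
    unfolding T_minus_def
  proof (rule deriv_op_refl_op_commute[OF refl_data_T_minus[OF ne(1)] _ _ _ assms(4,5)])
    fix k y show "dx i (\<lambda>x. of_real (swap l m x $ k)) y + of_real 0 * dx i (\<lambda>x. of_real (swap l m x $ k)) y
      = dx i (\<lambda>x. of_real (x $ k)) (swap l m y) + of_real 0 * dx i (\<lambda>x. of_real (x $ k)) (swap l m y)"
      using ne by (cases "k = l"; cases "k = m") (auto simp: refl_nth dx_coord)
  qed (use ne in \<open>auto simp: refl_nth dx_poly_simps\<close>)
  then show ?thesis by simp
qed

lemma deriv_op_T_plus_commute:
  assumes ne: "l \<noteq> m" "i \<noteq> l" "i \<noteq> m" and "polyf P" "reg x"
  shows "deriv_op \<delta> i (T_plus l m P) x = T_plus l m (deriv_op \<delta> i P) x"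
proof -
  have "deriv_op \<delta> i (T_plus l m P) x + of_real 0 * deriv_op \<delta> i (T_plus l m P) x
      = T_plus l m (\<lambda>x. deriv_op \<delta> i P x + of_real 0 * deriv_op \<delta> i P x) x"
    unfolding T_plus_def
  proof (rule deriv_op_refl_op_commute[OF refl_data_T_plus[OF ne(1)] _ _ _ assms(4,5)])
    fix k y show "dx i (\<lambda>x. of_real (neg_swap l m x $ k)) y
        + of_real 0 * dx i (\<lambda>x. of_real (neg_swap l m x $ k)) y
      = dx i (\<lambda>x. of_real (x $ k)) (neg_swap l m y)
        + of_real 0 * dx i (\<lambda>x. of_real (x $ k)) (neg_swap l m y)"
      using ne by (cases "k = l"; cases "k = m")
        (auto simp: refl_nth dx_coord dx_cmult[OF polyf_coord, of _ "-1", simplified])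
  qed (use ne in \<open>auto simp: refl_nth dx_poly_simps\<close>)
  then show ?thesis by simp
qed

lemma deriv_op_T_short_commute:
  assumes ne: "i \<noteq> l" and "polyf P" "reg x"
  shows "deriv_op \<delta> i (T_short b \<iota> l P) x = T_short b \<iota> l (deriv_op \<delta> i P) x"
proof -
  have "deriv_op \<delta> i (T_short b \<iota> l P) x + of_real 0 * deriv_op \<delta> i (T_short b \<iota> l P) x
      = T_short b \<iota> l (\<lambda>x. deriv_op \<delta> i P x + of_real 0 * deriv_op \<delta> i P x) x"
    unfolding T_short_def
  proof (rule deriv_op_refl_op_commute[OF refl_data_T_short _ _ _ assms(2,3)])
    fix k y show "dx i (\<lambda>x. of_real (neg_coord l x $ k)) y
        + of_real 0 * dx i (\<lambda>x. of_real (neg_coord l x $ k)) y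
      = dx i (\<lambda>x. of_real (x $ k)) (neg_coord l y)
        + of_real 0 * dx i (\<lambda>x. of_real (x $ k)) (neg_coord l y)"
      using ne by (cases "k = l")
        (auto simp: refl_nth dx_coord dx_cmult[OF polyf_coord, of _ "-1", simplified])
  qed (use ne in \<open>auto simp: refl_nth dx_poly_simps\<close>)
  then show ?thesis by simp
qed

lemma regpoly_T:
  "regpoly G \<Longrightarrow> i \<noteq> j \<Longrightarrow> regpoly (T_minus i j G)"
  "regpoly G \<Longrightarrow> i \<noteq> j \<Longrightarrow> regpoly (T_plus i j G)"
  "regpoly G \<Longrightarrow> regpoly (T_short b \<iota> j G)"
  unfolding T_minus_def T_plus_def T_short_def
  by (blast intro: regpoly_refl_op refl_data_T_minus refl_data_T_plus refl_data_T_short)+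

lemma regpoly_T_pair:
  assumes "regpoly G" "i \<noteq> j"
  shows "regpoly (T_pair i j G)"
proof (cases "i < j")
  case True
  then show ?thesis using regpoly_T(1,2)[OF assms] by (simp add: T_pair_def[abs_def] regpoly_add)
next
  case False
  then show ?thesis using regpoly_T(1)[OF assms(1) assms(2)[symmetric]] regpoly_T(2)[OF assms]
    regpoly_diff[of "T_plus i j G" "T_minus j i G"] by (simp add: T_pair_def[abs_def])
qed

lemma regpoly_T_total: "regpoly G \<Longrightarrow> regpoly (T_total a b \<iota> j G)"
  unfolding T_total_def[abs_def]
  by (intro regpoly_add regpoly_cmult regpoly_sum regpoly_T_pair regpoly_T) auto

lemma polyf_deriv_op: "polyf P \<Longrightarrow> polyf (deriv_op \<delta> j P)"
  unfolding deriv_op_def[abs_def] by (intro polyf_intros polyf_dx)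

lemma deriv_op_reg:
  assumes "reg x"
  shows deriv_op_add_reg: "regpoly F \<Longrightarrow> regpoly G \<Longrightarrow> deriv_op \<delta> j (\<lambda>x. F x + G x) x = deriv_op \<delta> j F x + deriv_op \<delta> j G x"
    and deriv_op_cmult_reg: "regpoly F \<Longrightarrow> deriv_op \<delta> j (\<lambda>x. c * F x) x = c * deriv_op \<delta> j F x"
    and deriv_op_sum_reg: "(\<And>k. k \<in> S \<Longrightarrow> regpoly (H k)) \<Longrightarrow>
      deriv_op \<delta> j (\<lambda>x. \<Sum>k\<in>S. H k x) x = (\<Sum>k\<in>S. deriv_op \<delta> j (H k) x)"
  using assms
  by (simp_all add: deriv_op_def dx_add_reg dx_cmult_reg dx_sum_reg sum.distrib sum_distrib_left algebra_simps)

lemma deriv_op_diff_reg: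
  assumes "reg x" "regpoly F" "regpoly G"
  shows "deriv_op \<delta> j (\<lambda>x. F x - G x) x = deriv_op \<delta> j F x - deriv_op \<delta> j G x"
  using deriv_op_add_reg[OF assms(1,2) regpoly_uminus[OF assms(3)], of \<delta> j]
    deriv_op_cmult_reg[OF assms(1,3), of \<delta> j "-1"] by simp

lemma deriv_op_T_pair_commute:
  assumes ne: "l \<noteq> m" "i \<noteq> l" "i \<noteq> m" and P: "polyf P" and x: "reg x"
  shows "deriv_op \<delta> i (T_pair l m P) x = T_pair l m (deriv_op \<delta> i P) x"
proof -
  note rp = regpoly_T(1,2)[OF polyf_regpoly[OF P] ne(1)] regpoly_T(1)[OF polyf_regpoly[OF P] ne(1)[symmetric]]
  show ?thesis
  proof (cases "l < m")
    case True
    then show ?thesis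
      using deriv_op_add_reg[OF x rp(1,2)] deriv_op_T_minus_commute[OF ne P x] deriv_op_T_plus_commute[OF ne P x]
      by (simp add: T_pair_def[abs_def])
  next
    case False
    then show ?thesis
      using deriv_op_diff_reg[OF x rp(2,3)] deriv_op_T_minus_commute[OF ne(1)[symmetric] ne(3,2) P x]
        deriv_op_T_plus_commute[OF ne P x]
      by (simp add: T_pair_def[abs_def])
  qed
qed

text \<open>Neither commutator vanishes, but they agree. With A = \<open>T_minus j l\<close> and B =
  \<open>T_plus j l\<close>, their difference is [d_j, B - A] - [d_l, A + B] = [d_j - d_l, B] -
  [d_j + d_l, A], and both brackets on the right are zero.\<close>

lemma deriv_op_T_pair_exchange:
  assumes jl: "j < l" and P: "polyf P" and x: "reg x"
  shows "deriv_op \<delta> j (T_pair l j P) x - T_pair l j (deriv_op \<delta> j P) x = deriv_op \<delta> l (T_pair j l P) x - T_pair j l (deriv_op \<delta> l P) x"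
proof -
  have ne: "j \<noteq> l" and n: "\<not> l < j" using jl by auto
  note rp = regpoly_T(1,2)[OF polyf_regpoly[OF P] ne]
  have e: "deriv_op \<delta> j (T_pair l j P) x = deriv_op \<delta> j (T_plus j l P) x - deriv_op \<delta> j (T_minus j l P) x"
    "deriv_op \<delta> l (T_pair j l P) x = deriv_op \<delta> l (T_minus j l P) x + deriv_op \<delta> l (T_plus j l P) x"
    "T_pair l j (deriv_op \<delta> j P) x = T_plus j l (deriv_op \<delta> j P) x - T_minus j l (deriv_op \<delta> j P) x"
    "T_pair j l (deriv_op \<delta> l P) x = T_minus j l (deriv_op \<delta> l P) x + T_plus j l (deriv_op \<delta> l P) x"
    using deriv_op_add_reg[OF x rp, of \<delta> l] deriv_op_diff_reg[OF x rp(2,1), of \<delta> j]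
    by (simp_all add: T_pair_def[abs_def] jl n T_plus_sym[of l j])
  have "deriv_op \<delta> j (T_pair l j P) x - T_pair l j (deriv_op \<delta> j P) x - (deriv_op \<delta> l (T_pair j l P) x - T_pair j l (deriv_op \<delta> l P) x)
    = (deriv_op \<delta> j (T_plus j l P) x - deriv_op \<delta> l (T_plus j l P) x - (T_plus j l (deriv_op \<delta> j P) x - T_plus j l (deriv_op \<delta> l P) x))
      - (deriv_op \<delta> j (T_minus j l P) x + deriv_op \<delta> l (T_minus j l P) x - (T_minus j l (deriv_op \<delta> j P) x + T_minus j l (deriv_op \<delta> l P) x))"
    unfolding e by simp
  also have "\<dots> = 0"
    unfolding deriv_op_T_minus_sum[OF ne P x] deriv_op_T_plus_diff[OF ne P x] by (simp add: linear_op_T_simps)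
  finally show ?thesis by simp
qed

text \<open>Of all the reflections in the operator of index l, only those for the pair {j, l} move
  the coordinate j.\<close>

lemma deriv_op_T_total_defect:
  assumes ne: "j \<noteq> l" and P: "polyf P" and x: "reg x"
  shows "deriv_op \<delta> j (T_total a b \<iota> l P) x - T_total a b \<iota> l (deriv_op \<delta> j P) x = a * (deriv_op \<delta> j (T_pair l j P) x - T_pair l j (deriv_op \<delta> j P) x)"
proof -
  note rp = polyf_regpoly[OF P]
  have "deriv_op \<delta> j (T_total a b \<iota> l P) x = a * (\<Sum>k\<in>UNIV - {l}. deriv_op \<delta> j (T_pair l k P) x) + deriv_op \<delta> j (T_short b \<iota> l P) x"
  proof -
    have s: "regpoly (\<lambda>x. \<Sum>k\<in>UNIV - {l}. T_pair l k P x)"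
      by (intro regpoly_sum regpoly_T_pair rp) auto
    have "deriv_op \<delta> j (\<lambda>x. \<Sum>k\<in>UNIV - {l}. T_pair l k P x) x = (\<Sum>k\<in>UNIV - {l}. deriv_op \<delta> j (T_pair l k P) x)"
      by (intro deriv_op_sum_reg[OF x] regpoly_T_pair rp) auto
    then show ?thesis
      unfolding T_total_def[abs_def]
      using deriv_op_add_reg[OF x regpoly_cmult[OF s] regpoly_T(3)[OF rp]] deriv_op_cmult_reg[OF x s] by simp
  qed
  moreover have "UNIV - {l} = insert j (UNIV - {j, l})" using ne by auto
  moreover have "(\<Sum>k\<in>UNIV - {j, l}. deriv_op \<delta> j (T_pair l k P) x) = (\<Sum>k\<in>UNIV - {j, l}. T_pair l k (deriv_op \<delta> j P) x)"
    using ne by (intro sum.cong refl deriv_op_T_pair_commute P x) auto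
  ultimately show ?thesis
    using deriv_op_T_short_commute[OF ne P x] by (simp add: T_total_def algebra_simps)
qed

lemma deriv_op_commute:
  assumes "polyf P" "i \<noteq> j"
  shows "deriv_op \<delta> i (deriv_op \<delta> j P) x = deriv_op \<delta> j (deriv_op \<delta> i P) x"
  using assms dx_commute[OF assms]
  by (simp add: deriv_op_def[abs_def] dx_poly_simps polyf_dx algebra_simps)

text \<open>The operator \<open>D\<^sub>j\<close> conjugated by \<open>|SH|\<^sup>\<delta>\<close>; the singular quotients inside \<open>T_total\<close> have junk values at
  points which are not \<open>reg\<close>.\<close>

definition cherednik_poly :: "complex \<Rightarrow> complex \<Rightarrow> complex \<Rightarrow> complex \<Rightarrow> 'n::{finite,linorder} \<Rightarrow>
    (real ^ 'n::{finite,linorder} \<Rightarrow> complex) \<Rightarrow> real ^ 'n::{finite,linorder} \<Rightarrow> complex"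
  where "cherednik_poly a b \<iota> \<delta> j G x = deriv_op \<delta> j G x + T_total a b \<iota> j G x - rho a b \<iota> j * G x"

lemma T_total_cong_reg:
  assumes "\<And>y. reg y \<Longrightarrow> F y = G y" "reg x"
  shows "T_total a b \<iota> j F x = T_total a b \<iota> j G x"
proof -
  have "refl_op c w F x = refl_op c w G x" if "reg (w x)" for c w
    by (rule refl_op_cong_reg) (use assms that in auto)
  then show ?thesis by (simp add: T_total_def T_pair_def T_minus_def T_plus_def T_short_def reg_refl assms(2) cong: if_cong)
qed

lemma cherednik_poly_cong_reg:
  assumes "\<And>y. reg y \<Longrightarrow> F y = G y" "reg x"
  shows "cherednik_poly a b \<iota> \<delta> j F x = cherednik_poly a b \<iota> \<delta> j G x"
  using assms T_total_cong_reg[of F G, OF assms] dx_cong_reg[of x F G] by (simp add: cherednik_poly_def deriv_op_def)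

lemma regpoly_cherednik_poly: "regpoly G \<Longrightarrow> regpoly (cherednik_poly a b \<iota> \<delta> j G)"
  unfolding cherednik_poly_def[abs_def] deriv_op_def
  by (simp add: regpoly_add regpoly_diff regpoly_cmult regpoly_mult regpoly_T_total regpoly_dx
      polyf_regpoly polyf_intros)

lemma cherednik_poly_add_reg:
  assumes "regpoly F" "regpoly G" "reg x"
  shows "cherednik_poly a b \<iota> \<delta> j (\<lambda>x. F x + G x) x = cherednik_poly a b \<iota> \<delta> j F x + cherednik_poly a b \<iota> \<delta> j G x"
  using assms by (simp add: cherednik_poly_def deriv_op_add_reg linear_op_add[OF linear_op_T_total] algebra_simps)

lemma cherednik_poly_cmult_reg:
  assumes "regpoly F" "reg x"
  shows "cherednik_poly a b \<iota> \<delta> j (\<lambda>x. c * F x) x = c * cherednik_poly a b \<iota> \<delta> j F x"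
  using assms by (simp add: cherednik_poly_def deriv_op_cmult_reg linear_op_cmult[OF linear_op_T_total] algebra_simps)

text \<open>The derivations commute and the reflection parts commute. The mixed commutators cancel
  each other, since by the exchange lemma the two defects are equal.\<close>

lemma cherednik_poly_commute_polyf:
  assumes "j < l" and P: "polyf P" and x: "reg x"
  shows "cherednik_poly a b \<iota> \<delta> j (cherednik_poly a b \<iota> \<delta> l P) x = cherednik_poly a b \<iota> \<delta> l (cherednik_poly a b \<iota> \<delta> j P) x"
proof -
  have ne: "j \<noteq> l" using assms(1) by simp
  note rp = polyf_regpoly[OF P]
  have e: "cherednik_poly a b \<iota> \<delta> i (cherednik_poly a b \<iota> \<delta> k P) x = deriv_op \<delta> i (deriv_op \<delta> k P) x + deriv_op \<delta> i (T_total a b \<iota> k P) x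
      - rho a b \<iota> k * deriv_op \<delta> i P x + T_total a b \<iota> i (deriv_op \<delta> k P) x + T_total a b \<iota> i (T_total a b \<iota> k P) x
      - rho a b \<iota> k * T_total a b \<iota> i P x - rho a b \<iota> i * (deriv_op \<delta> k P x + T_total a b \<iota> k P x - rho a b \<iota> k * P x)"
    for i k
  proof -
    have "deriv_op \<delta> i (\<lambda>x. deriv_op \<delta> k P x + T_total a b \<iota> k P x - rho a b \<iota> k * P x) x
      = deriv_op \<delta> i (deriv_op \<delta> k P) x + deriv_op \<delta> i (T_total a b \<iota> k P) x - rho a b \<iota> k * deriv_op \<delta> i P x"
      using x rp polyf_regpoly[OF polyf_deriv_op[OF P]]
      by (simp add: deriv_op_diff_reg deriv_op_add_reg deriv_op_cmult_reg regpoly_add regpoly_T_total regpoly_cmult)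
    then show ?thesis
      by (simp add: cherednik_poly_def[abs_def] linear_op_add[OF linear_op_T_total] linear_op_diff[OF linear_op_T_total] linear_op_cmult[OF linear_op_T_total])
  qed
  have vr: "deriv_op \<delta> j (T_total a b \<iota> l P) x - T_total a b \<iota> l (deriv_op \<delta> j P) x = deriv_op \<delta> l (T_total a b \<iota> j P) x - T_total a b \<iota> j (deriv_op \<delta> l P) x"
    unfolding deriv_op_T_total_defect[OF ne P x] deriv_op_T_total_defect[OF ne[symmetric] P x] deriv_op_T_pair_exchange[OF assms(1) P x] ..
  show ?thesis
    unfolding e
    using deriv_op_commute[OF P ne, of \<delta> x] T_total_commute[OF x assms(1), of a b \<iota> P]
      vr
    by (simp add: algebra_simps)
qed

lemma cherednik_poly_commute:
  assumes "regpoly G" "reg x"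
  shows "cherednik_poly a b \<iota> \<delta> j (cherednik_poly a b \<iota> \<delta> l G) x = cherednik_poly a b \<iota> \<delta> l (cherednik_poly a b \<iota> \<delta> j G) x"
proof -
  obtain P where P: "polyf P" "\<And>x. reg x \<Longrightarrow> G x = P x" using assms(1) by (auto elim: regpolyE)
  have "cherednik_poly a b \<iota> \<delta> i (cherednik_poly a b \<iota> \<delta> k G) x = cherednik_poly a b \<iota> \<delta> i (cherednik_poly a b \<iota> \<delta> k P) x" for i k
    by (intro cherednik_poly_cong_reg assms P)
  then show ?thesis
    using cherednik_poly_commute_polyf[OF _ P(1) assms(2), of j l] cherednik_poly_commute_polyf[OF _ P(1) assms(2), of l j]
    by (cases j l rule: linorder_cases) simp_all
qed

subsection \<open>The elementary steps of the evaluation\<close>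

text \<open>All functions met in the evaluation are products of functions of one coordinate. A
  reflection changes at most two of the factors, so each step becomes an identity in one or two
  variables.\<close>

definition coord_prod :: "('n \<Rightarrow> complex \<Rightarrow> complex) \<Rightarrow> real ^ 'n::finite \<Rightarrow> complex"
  where "coord_prod g x = (\<Prod>i\<in>UNIV. g i (of_real (x $ i)))"

lemma coord_prod_split2:
  assumes "i \<noteq> j"
  shows "coord_prod g x = g i (of_real (x $ i)) * g j (of_real (x $ j)) * (\<Prod>k\<in>UNIV - {i, j}. g k (of_real (x $ k)))"
proof -
  have "UNIV = insert i (insert j (UNIV - {i, j}))" by auto
  then show ?thesis
    unfolding coord_prod_def using assms
    by (metis (no_types, lifting) DiffD2 finite finite_insert insertCI insertE mult.assoc prod.insert)
qed

lemma coord_prod_split1: "coord_prod g x = g j (of_real (x $ j)) * (\<Prod>k\<in>UNIV - {j}. g k (of_real (x $ k)))"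
  unfolding coord_prod_def by (simp add: prod.remove)

lemma refl_op_coord_prod:
  fixes i j :: "'n::finite" and x :: "real ^ 'n"
  defines "X \<equiv> \<lambda>i. complex_of_real (x $ i)"
  shows refl_op_swap_coord_prod: "i \<noteq> j \<Longrightarrow> refl_op c (swap i j) (coord_prod g) x = c x * (g i (X i) * g j (X j) - g i (X j) * g j (X i))
      * (\<Prod>k\<in>UNIV - {i, j}. g k (X k))"
    and refl_op_neg_swap_coord_prod: "i \<noteq> j \<Longrightarrow> refl_op c (neg_swap i j) (coord_prod g) x
      = c x * (g i (X i) * g j (X j) - g i (- X j) * g j (- X i)) * (\<Prod>k\<in>UNIV - {i, j}. g k (X k))"
    and refl_op_neg_coord_coord_prod: "refl_op c (neg_coord j) (coord_prod g) x
      = c x * (g j (X j) - g j (- X j)) * (\<Prod>k\<in>UNIV - {j}. g k (X k))"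
  subgoal by (simp add: refl_op_def coord_prod_split2[of i j] refl_nth X_def algebra_simps)
  subgoal by (simp add: refl_op_def coord_prod_split2[of i j] refl_nth X_def algebra_simps)
  subgoal by (simp add: refl_op_def coord_prod_split1[of _ _ j] refl_nth X_def algebra_simps)
  done

lemma dx_independent:
  assumes "\<And>x h. F (x + h *\<^sub>R axis j 1) = F x"
  shows "dx j F = (\<lambda>x. 0)"
  by (simp add: fun_eq_iff dx_def partial_def assms)

lemma dx_coord_prod:
  assumes "\<And>i. polyf (\<lambda>x :: real ^ 'n::finite. g i (of_real (x $ i)))"
  shows "dx j (coord_prod g) x = dx j (\<lambda>x. g j (of_real (x $ j))) x * (\<Prod>k\<in>UNIV - {j}. g k (of_real (x $ k)))"
proof -
  have "dx j (\<lambda>x :: real ^ 'n. \<Prod>k\<in>UNIV - {j}. g k (of_real (x $ k))) = (\<lambda>x. 0)"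
    by (rule dx_independent) (auto simp: axis_def intro!: prod.cong)
  moreover have "polyf (\<lambda>x :: real ^ 'n. \<Prod>k\<in>UNIV - {j}. g k (of_real (x $ k)))"
    by (intro polyf_prod assms)
  moreover have "coord_prod g = (\<lambda>x. g j (of_real (x $ j)) * (\<Prod>k\<in>UNIV - {j}. g k (of_real (x $ k))))"
    by (rule ext) (rule coord_prod_split1)
  ultimately show ?thesis by (simp add: dx_mult assms)
qed

text \<open>The factor \<open>s\<close> is a number attached to the fixed point \<open>x\<close>, so
  it may involve the coordinates of \<open>x\<close>; it is x_j, 0, 1 or 1 + x_j below.\<close>

lemma T_pair_coord_prod:
  fixes j k :: "'n::{finite,linorder}" and x :: "real ^ 'n::{finite,linorder}"
  defines "X \<equiv> complex_of_real (x $ j)" and "Y \<equiv> complex_of_real (x $ k)"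
  assumes ne: "j \<noteq> k" and B: "(if j < k then long_coeff X Y * (g j X * g k Y - g j Y * g k X)
        else - (long_coeff Y X * (g j X * g k Y - g j Y * g k X)))
      + long_coeff X (- Y) * (g j X * g k Y - g j (- Y) * g k (- X)) = s * g j X * g k Y"
  shows "T_pair j k (coord_prod g) x = s * coord_prod g x"
proof -
  have "UNIV - {k, j} = UNIV - {j, k}" by auto
  then have "T_pair j k (coord_prod g) x = ((if j < k then long_coeff X Y * (g j X * g k Y - g j Y * g k X)
        else - (long_coeff Y X * (g j X * g k Y - g j Y * g k X)))
      + long_coeff X (- Y) * (g j X * g k Y - g j (- Y) * g k (- X))) * (\<Prod>k\<in>UNIV - {j, k}. g k (of_real (x $ k)))"
    using ne by (simp add: T_pair_def T_minus_def T_plus_def refl_op_coord_prod X_def Y_def algebra_simps)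
  then show ?thesis unfolding B by (simp add: coord_prod_split2[OF ne, of g x] X_def Y_def)
qed

text \<open>Positions are counted from 1, so j - 1 indices lie below j and r - j above.\<close>

lemma idx_card:
  fixes j :: "'n::{finite,linorder}"
  shows "of_nat (card {..<j}) = (of_nat (idx j) - 1 :: complex)"
    and "of_nat (card {j<..}) = (of_nat CARD('n) - of_nat (idx j) :: complex)"
proof -
  have "idx j = Suc (card {..<j})"
    unfolding idx_def by (simp flip: ivl_disj_un(2))
  then show "of_nat (card {..<j}) = (of_nat (idx j) - 1 :: complex)" by simp
  have "CARD('n) = idx j + card {j<..}"
    unfolding idx_def by (subst card_Un_disjoint[symmetric]) (auto intro!: arg_cong[where f = card])
  then show "of_nat (card {j<..}) = (of_nat CARD('n) - of_nat (idx j) :: complex)" by simp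
qed

lemma sum_split_linorder:
  fixes j :: "'n::{finite,linorder}" and s u :: complex
  shows "(\<Sum>k\<in>UNIV - {j}. if k < j then s else u)
    = (of_nat (idx j) - 1) * s + (of_nat CARD('n) - of_nat (idx j)) * u"
proof -
  have U: "UNIV - {j} = {..<j} \<union> {j<..}" by auto
  have "(\<Sum>k\<in>UNIV - {j}. if k < j then s else u)
      = (\<Sum>k\<in>{..<j}. if k < j then s else u) + (\<Sum>k\<in>{j<..}. if k < j then s else u)"
    unfolding U by (rule sum.union_disjoint) auto
  also have "(\<Sum>k\<in>{..<j}. if k < j then s else u) = (\<Sum>k\<in>{..<j}. s)"
    by (rule sum.cong) auto
  also have "(\<Sum>k\<in>{j<..}. if k < j then s else u) = (\<Sum>k\<in>{j<..}. u)"
    by (rule sum.cong) auto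
  finally show ?thesis by (simp add: idx_card)
qed

lemma rho_Min:
  "rho a b \<iota> (Min (UNIV :: 'n::{finite,linorder} set)) = \<iota> + b + a * (of_nat CARD('n) - 1)"
proof -
  have "{..Min (UNIV :: 'n set)} = {Min UNIV}" by (auto intro: antisym Min_le)
  then show ?thesis by (simp add: rho_def idx_def)
qed

text \<open>The product does not involve x_j, so the derivative and the short reflection give 0.
  Each k < j contributes a x_j and each k > j nothing, which with \<delta> x_j makes (\<delta> + a
  (j - 1)) x_j. The constant term \<delta> + rho_1 - rho_j is the same number, whence the factor 1 +
  x_j.\<close>

lemma cherednik_poly_plus_step:
  fixes j :: "'n::{finite,linorder}"
  assumes x: "reg x"
  shows "cherednik_poly a b \<iota> \<delta> j (\<lambda>x. \<Prod>i\<in>{..<j}. 1 + of_real (x $ i)) x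
      + (\<delta> + rho a b \<iota> (Min (UNIV :: 'n set))) * (\<Prod>i\<in>{..<j}. 1 + of_real (x $ i))
    = (\<delta> + a * (of_nat (idx j) - 1)) * (1 + of_real (x $ j)) * (\<Prod>i\<in>{..<j}. 1 + of_real (x $ i))"
proof -
  define g :: "'n \<Rightarrow> complex \<Rightarrow> complex" where "g = (\<lambda>i u. if i < j then 1 + u else 1)"
  have E: "(\<lambda>x. \<Prod>i\<in>{..<j}. 1 + of_real (x $ i)) = coord_prod g"
  proof
    fix x :: "real ^ 'n::{finite,linorder}"
    have "coord_prod g x = (\<Prod>i\<in>UNIV \<inter> {i. i < j}. 1 + of_real (x $ i))"
      unfolding coord_prod_def g_def by (subst prod.inter_restrict) simp_all
    then show "(\<Prod>i\<in>{..<j}. 1 + of_real (x $ i)) = coord_prod g x" by (simp add: lessThan_def)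
  qed
  have pg: "polyf (\<lambda>x :: real ^ 'n::{finite,linorder}. g i (of_real (x $ i)))" for i
    by (cases "i < j") (simp_all add: g_def polyf_intros)
  have dx: "dx j (coord_prod g) x = 0"
    unfolding dx_coord_prod[OF pg] by (simp add: g_def dx_const)
  have T_short: "T_short b \<iota> j (coord_prod g) x = 0"
    unfolding T_short_def refl_op_neg_coord_coord_prod by (simp add: g_def)
  have "T_pair j k (coord_prod g) x = (if k < j then of_real (x $ j) else 0) * coord_prod g x" if "k \<noteq> j" for k
  proof (rule T_pair_coord_prod)
    define X Y where "X = complex_of_real (x $ j)" "Y = complex_of_real (x $ k)"
    have ne: "Y \<noteq> X" "X \<noteq> - Y"
      using reg_distinct[OF x that] reg_distinct_neg[OF x that[symmetric]]
      by (auto simp: X_Y_def simp flip: of_real_minus)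
    show "(if j < k then long_coeff X Y * (g j X * g k Y - g j Y * g k X)
        else - (long_coeff Y X * (g j X * g k Y - g j Y * g k X)))
      + long_coeff X (- Y) * (g j X * g k Y - g j (- Y) * g k (- X))
      = (if k < j then X else 0) * g j X * g k Y"
    proof (cases "k < j")
      case True
      have "- (long_coeff Y X * ((1 + Y) - (1 + X))) + long_coeff X (- Y) * ((1 + Y) - (1 - X)) = X * (1 + Y)"
        using long_coeff_eq[OF ne(1)] long_coeff_eq[OF ne(2)] by algebra
      moreover have "\<not> j < k" using True by simp
      ultimately show ?thesis using True by (simp add: g_def)
    next
      case False
      with that show ?thesis by (simp add: g_def)
    qed
  qed (use that in simp)
  then have "(\<Sum>k\<in>UNIV - {j}. T_pair j k (coord_prod g) x)
      = (\<Sum>k\<in>UNIV - {j}. if k < j then of_real (x $ j) else 0) * coord_prod g x"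
    by (simp add: sum_distrib_right)
  then have T_total: "T_total a b \<iota> j (coord_prod g) x = a * (of_nat (idx j) - 1) * of_real (x $ j) * coord_prod g x"
    by (simp add: T_total_def T_short sum_split_linorder)
  show ?thesis
    unfolding fun_cong[OF E, of x] E cherednik_poly_def deriv_op_def dx T_total rho_Min
    by (simp add: rho_def algebra_simps)
qed

text \<open>As multiples of \<open>G\<close>, the derivative gives 1 - x_j, the conjugation \<delta>
  x_j, the short reflection \<iota> (1 + x_j) + 2b x_j, each k < j gives a and each k > j gives a (1
  + x_j). After subtraction of rho_j and \<delta> + rho_1 the constant term is minus the coefficient
  of x_j, whence the factor x_j - 1.\<close>

lemma cherednik_poly_minus_step:
  fixes j :: "'n::{finite,linorder}"
  defines "G \<equiv> \<lambda>x :: real ^ 'n::{finite,linorder}. (\<Prod>i\<in>{j<..}. of_real (x $ i) - 1) * (\<Prod>i\<in>UNIV. 1 + of_real (x $ i))"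
  assumes x: "reg x"
  shows "cherednik_poly a b \<iota> \<delta> j G x - (\<delta> + rho a b \<iota> (Min (UNIV :: 'n set))) * G x
    = (\<delta> - 1 + \<iota> + 2 * b + a * (of_nat CARD('n) - of_nat (idx j))) * (of_real (x $ j) - 1) * G x"
proof -
  define g :: "'n \<Rightarrow> complex \<Rightarrow> complex" where "g = (\<lambda>i u. (if j < i then u - 1 else 1) * (1 + u))"
  have E: "G = coord_prod g"
  proof
    fix x :: "real ^ 'n::{finite,linorder}"
    have "coord_prod g x = (\<Prod>i\<in>UNIV \<inter> {i. j < i}. of_real (x $ i) - 1) * (\<Prod>i\<in>UNIV. 1 + of_real (x $ i))"
      unfolding coord_prod_def g_def prod.distrib by (subst prod.inter_restrict) simp_all
    then show "G x = coord_prod g x" by (simp add: G_def greaterThan_def)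
  qed
  have pg: "polyf (\<lambda>x :: real ^ 'n::{finite,linorder}. g i (of_real (x $ i)))" for i
    by (cases "j < i") (simp_all add: g_def polyf_intros)
  have dx: "dx j (coord_prod g) x = (1 - of_real (x $ j)) * coord_prod g x"
    unfolding dx_coord_prod[OF pg] coord_prod_split1[of g x j]
    by (simp add: g_def dx_poly_simps algebra_simps)
  have "complex_of_real (x $ j) \<noteq> 0" using reg_nonzero[OF x] by simp
  then have "short_coeff b \<iota> (of_real (x $ j)) * (2 * of_real (x $ j))
      = (\<iota> * (1 + of_real (x $ j)) + 2 * b * of_real (x $ j)) * (1 + of_real (x $ j))"
    by (simp add: short_coeff_def field_simps power2_eq_square)
  then have T_short: "T_short b \<iota> j (coord_prod g) x = (\<iota> * (1 + of_real (x $ j)) + 2 * b * of_real (x $ j)) * coord_prod g x"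
    unfolding T_short_def refl_op_neg_coord_coord_prod coord_prod_split1[of g x j] by (simp add: g_def)
  have "T_pair j k (coord_prod g) x = (if k < j then 1 else 1 + of_real (x $ j)) * coord_prod g x" if "k \<noteq> j" for k
  proof (rule T_pair_coord_prod)
    define X Y where "X = complex_of_real (x $ j)" "Y = complex_of_real (x $ k)"
    have ne: "X \<noteq> Y" "X \<noteq> - Y"
      using reg_distinct[OF x that] reg_distinct_neg[OF x that[symmetric]]
      by (auto simp: X_Y_def eq_neg_iff_add_eq_0 simp flip: of_real_minus of_real_add)
    show "(if j < k then long_coeff X Y * (g j X * g k Y - g j Y * g k X)
        else - (long_coeff Y X * (g j X * g k Y - g j Y * g k X)))
      + long_coeff X (- Y) * (g j X * g k Y - g j (- Y) * g k (- X))
      = (if k < j then 1 else 1 + X) * g j X * g k Y"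
    proof (cases "k < j")
      case True
      have "long_coeff X (- Y) * ((1 + X) * (1 + Y) - (1 - Y) * (1 - X)) = (1 + X) * (1 + Y)"
        using long_coeff_eq[OF ne(2)] by algebra
      moreover have "\<not> j < k" using True by simp
      ultimately show ?thesis using True by (simp add: g_def)
    next
      case False
      have "long_coeff X Y * ((1 + X) * ((Y - 1) * (1 + Y)) - (1 + Y) * ((X - 1) * (1 + X)))
        + long_coeff X (- Y) * ((1 + X) * ((Y - 1) * (1 + Y)) - (1 - Y) * ((- X - 1) * (1 - X)))
        = (1 + X) * ((1 + X) * ((Y - 1) * (1 + Y)))"
        using long_coeff_eq[OF ne(1)] long_coeff_eq[OF ne(2)] by algebra
      with False that show ?thesis by (simp add: g_def)
    qed
  qed (use that in simp)
  then have "(\<Sum>k\<in>UNIV - {j}. T_pair j k (coord_prod g) x)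
      = (\<Sum>k\<in>UNIV - {j}. if k < j then 1 else 1 + of_real (x $ j)) * coord_prod g x"
    by (simp add: sum_distrib_right)
  also have "\<dots> = ((of_nat (idx j) - 1) + (of_nat CARD('n) - of_nat (idx j)) * (1 + of_real (x $ j)))
      * coord_prod g x"
    unfolding sum_split_linorder by simp
  finally have S: "(\<Sum>k\<in>UNIV - {j}. T_pair j k (coord_prod g) x)
    = ((of_nat (idx j) - 1) + (of_nat CARD('n) - of_nat (idx j)) * (1 + of_real (x $ j))) * coord_prod g x" .
  have T_total: "T_total a b \<iota> j (coord_prod g) x = (a * ((of_nat (idx j) - 1)
      + (of_nat CARD('n) - of_nat (idx j)) * (1 + of_real (x $ j)))
      + \<iota> * (1 + of_real (x $ j)) + 2 * b * of_real (x $ j)) * coord_prod g x"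
    unfolding T_total_def T_short S by (simp add: algebra_simps)
  show ?thesis
    unfolding E cherednik_poly_def deriv_op_def dx T_total rho_Min
    by (simp add: rho_def algebra_simps)
qed

subsection \<open>Reordering the factors\<close>

text \<open>Equality up to the values on the hyperplanes. The operators respect it because regular
  points are open and stable under the reflections.\<close>

definition reg_eq :: "(real ^ 'n::finite \<Rightarrow> complex) \<Rightarrow> (real ^ 'n \<Rightarrow> complex) \<Rightarrow> bool" (infix "\<simeq>" 50)
  where "F \<simeq> G \<longleftrightarrow> (\<forall>x. reg x \<longrightarrow> F x = G x)"

lemma reg_eq_refl: "F \<simeq> F"
  and reg_eq_trans[trans]: "F \<simeq> G \<Longrightarrow> G \<simeq> H \<Longrightarrow> F \<simeq> H"
  by (auto simp: reg_eq_def)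

definition shifted_cherednik_poly :: "complex \<Rightarrow> complex \<Rightarrow> complex \<Rightarrow> complex \<Rightarrow> complex \<Rightarrow> 'n::{finite,linorder} \<Rightarrow>
    (real ^ 'n::{finite,linorder} \<Rightarrow> complex) \<Rightarrow> real ^ 'n::{finite,linorder} \<Rightarrow> complex"
  where "shifted_cherednik_poly a b \<iota> \<delta> c j G x = cherednik_poly a b \<iota> \<delta> j G x + c * G x"

lemma shifted_cherednik_poly_cong: "F \<simeq> G \<Longrightarrow> shifted_cherednik_poly a b \<iota> \<delta> c j F \<simeq> shifted_cherednik_poly a b \<iota> \<delta> c j G"
  using cherednik_poly_cong_reg[of F G] by (simp add: reg_eq_def shifted_cherednik_poly_def)

lemma shifted_cherednik_poly_cmult: "regpoly F \<Longrightarrow> shifted_cherednik_poly a b \<iota> \<delta> c j (\<lambda>x. d * F x) \<simeq> (\<lambda>x. d * shifted_cherednik_poly a b \<iota> \<delta> c j F x)"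
  by (simp add: reg_eq_def shifted_cherednik_poly_def cherednik_poly_cmult_reg algebra_simps)

lemma regpoly_shifted_cherednik_poly: "regpoly G \<Longrightarrow> regpoly (shifted_cherednik_poly a b \<iota> \<delta> c j G)"
  unfolding shifted_cherednik_poly_def[abs_def] by (intro regpoly_add regpoly_cmult regpoly_cherednik_poly)

lemma shifted_cherednik_poly_commute:
  assumes "regpoly G"
  shows "shifted_cherednik_poly a b \<iota> \<delta> c j (shifted_cherednik_poly a b \<iota> \<delta> d l G) \<simeq> shifted_cherednik_poly a b \<iota> \<delta> d l (shifted_cherednik_poly a b \<iota> \<delta> c j G)"
  using cherednik_poly_commute[OF assms] assms
  by (simp add: reg_eq_def shifted_cherednik_poly_def[abs_def] cherednik_poly_add_reg cherednik_poly_cmult_reg regpoly_cherednik_poly regpoly_cmult algebra_simps)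

lemma regpoly_foldr: "regpoly G \<Longrightarrow> regpoly (foldr (shifted_cherednik_poly a b \<iota> \<delta> c) js G)"
  by (induction js) (simp_all add: regpoly_shifted_cherednik_poly)

lemma foldr_cong_reg_eq: "F \<simeq> G \<Longrightarrow> foldr (shifted_cherednik_poly a b \<iota> \<delta> c) js F \<simeq> foldr (shifted_cherednik_poly a b \<iota> \<delta> c) js G"
  by (induction js) (simp_all add: shifted_cherednik_poly_cong)

lemma shifted_cherednik_poly_foldr_commute:
  assumes "regpoly G"
  shows "shifted_cherednik_poly a b \<iota> \<delta> c j (foldr (shifted_cherednik_poly a b \<iota> \<delta> d) js G) \<simeq> foldr (shifted_cherednik_poly a b \<iota> \<delta> d) js (shifted_cherednik_poly a b \<iota> \<delta> c j G)"
proof (induction js)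
  case (Cons l js)
  then show ?case
    using reg_eq_trans[OF shifted_cherednik_poly_commute[OF regpoly_foldr[OF assms]] shifted_cherednik_poly_cong[OF Cons]] by simp
qed (simp add: reg_eq_refl)

definition M_poly :: "complex \<Rightarrow> complex \<Rightarrow> complex \<Rightarrow> complex \<Rightarrow> complex \<Rightarrow> 'n::{finite,linorder} \<Rightarrow>
    (real ^ 'n::{finite,linorder} \<Rightarrow> complex) \<Rightarrow> real ^ 'n::{finite,linorder} \<Rightarrow> complex"
  where "M_poly a b \<iota> \<delta> c j G x = cherednik_poly a b \<iota> \<delta> j (cherednik_poly a b \<iota> \<delta> j G) x - c\<^sup>2 * G x"

lemma M_poly_factor:
  assumes "regpoly G"
  shows "M_poly a b \<iota> \<delta> c j G \<simeq> shifted_cherednik_poly a b \<iota> \<delta> (- c) j (shifted_cherednik_poly a b \<iota> \<delta> c j G)"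
  using assms
  by (simp add: reg_eq_def shifted_cherednik_poly_def[abs_def] M_poly_def cherednik_poly_add_reg cherednik_poly_cmult_reg regpoly_cherednik_poly regpoly_cmult
      algebra_simps power2_eq_square)

lemma M_poly_cong: "F \<simeq> G \<Longrightarrow> M_poly a b \<iota> \<delta> c j F \<simeq> M_poly a b \<iota> \<delta> c j G"
  using cherednik_poly_cong_reg[of F G] cherednik_poly_cong_reg[of "cherednik_poly a b \<iota> \<delta> j F" "cherednik_poly a b \<iota> \<delta> j G"]
  by (simp add: reg_eq_def M_poly_def)

text \<open>Each new factor D_j + c is moved inwards past all factors already present and ends up
  innermost, next to \<open>G\<close>. This reverses the order of the plus factors and keeps that of
  the minus factors.\<close>

lemma foldr_M_poly:
  assumes "regpoly G"
  shows "foldr (M_poly a b \<iota> \<delta> c) js G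
    \<simeq> foldr (shifted_cherednik_poly a b \<iota> \<delta> (- c)) js (foldr (shifted_cherednik_poly a b \<iota> \<delta> c) (rev js) G)"
proof (induction js)
  case (Cons j js)
  let ?m = "shifted_cherednik_poly a b \<iota> \<delta> (- c)" and ?p = "shifted_cherednik_poly a b \<iota> \<delta> c"
  have "foldr (M_poly a b \<iota> \<delta> c) (j # js) G \<simeq> M_poly a b \<iota> \<delta> c j (foldr ?m js (foldr ?p (rev js) G))"
    using M_poly_cong[OF Cons] by simp
  also have "\<dots> \<simeq> ?m j (?p j (foldr ?m js (foldr ?p (rev js) G)))"
    by (intro M_poly_factor regpoly_foldr assms)
  also have "\<dots> \<simeq> ?m j (foldr ?m js (?p j (foldr ?p (rev js) G)))"
    by (intro shifted_cherednik_poly_cong shifted_cherednik_poly_foldr_commute regpoly_foldr assms)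
  also have "\<dots> \<simeq> ?m j (foldr ?m js (foldr ?p (rev js) (?p j G)))"
    by (intro shifted_cherednik_poly_cong foldr_cong_reg_eq shifted_cherednik_poly_foldr_commute assms)
  finally show ?case by simp
qed (simp add: reg_eq_refl)

text \<open>List positions start at 0: the first n entries are the indices strictly below entry
  n.\<close>

lemma sorted_UNIV_nth:
  fixes n :: nat
  defines "js \<equiv> sorted_list_of_set (UNIV :: 'n::{finite,linorder} set)"
  assumes "n < CARD('n)"
  shows "set (take n js) = {..<js ! n}" "set (drop (Suc n) js) = {js ! n<..}"
proof -
  have len: "length js = CARD('n)" by (simp add: js_def)
  have s: "sorted_wrt (<) js" unfolding js_def by (rule strict_sorted_list_of_set)
  have d: "js = take n js @ js ! n # drop (Suc n) js"
    using assms(2) len by (simp add: id_take_nth_drop)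
  then have "sorted_wrt (<) (take n js @ js ! n # drop (Suc n) js)" using s by simp
  then have lt: "\<forall>i\<in>set (take n js). i < js ! n" "\<forall>i\<in>set (drop (Suc n) js). js ! n < i"
    by (auto simp: sorted_wrt_append)
  have "UNIV = set js" by (simp add: js_def)
  also have "\<dots> = set (take n js) \<union> {js ! n} \<union> set (drop (Suc n) js)"
    by (subst d) auto
  finally have U: "i \<in> set (take n js) \<or> i = js ! n \<or> i \<in> set (drop (Suc n) js)" for i by auto
  show "set (take n js) = {..<js ! n}" "set (drop (Suc n) js) = {js ! n<..}"
    using lt U by (auto dest: less_asym)
qed

lemma foldr_plus:
  fixes a b \<iota> \<delta> :: complex
  defines "js \<equiv> sorted_list_of_set (UNIV :: 'n::{finite,linorder} set)"
    and "c \<equiv> \<delta> + rho a b \<iota> (Min (UNIV :: 'n set))"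
  assumes "n \<le> CARD('n)"
  shows "foldr (shifted_cherednik_poly a b \<iota> \<delta> c) (rev (take n js)) (\<lambda>x. 1)
    \<simeq> (\<lambda>x. (\<Prod>j\<in>set (take n js). \<delta> + a * (of_nat (idx j) - 1)) * (\<Prod>j\<in>set (take n js). 1 + of_real (x $ j)))"
  using assms(3)
proof (induction n)
  case 0
  show ?case by (simp add: reg_eq_refl)
next
  case (Suc n)
  let ?j = "js ! n" and ?d = "\<Prod>j\<in>set (take n js). \<delta> + a * (of_nat (idx j) - 1)"
  have n: "n < CARD('n)" "n < length js" using Suc.prems by (simp_all add: js_def)
  have t: "take (Suc n) js = take n js @ [?j]" using n by (simp add: take_Suc_conv_app_nth)
  have st: "set (take n js) = {..<?j}" using sorted_UNIV_nth[OF n(1)] by (simp add: js_def)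
  let ?E = "\<lambda>x. \<Prod>j\<in>{..<?j}. 1 + complex_of_real (x $ j)"
  have rp: "regpoly ?E" by (intro polyf_regpoly polyf_intros)
  have "foldr (shifted_cherednik_poly a b \<iota> \<delta> c) (rev (take (Suc n) js)) (\<lambda>x. 1)
      \<simeq> shifted_cherednik_poly a b \<iota> \<delta> c ?j (\<lambda>x. ?d * ?E x)"
    using Suc n by (simp add: t st shifted_cherednik_poly_cong)
  also have "\<dots> \<simeq> (\<lambda>x. ?d * shifted_cherednik_poly a b \<iota> \<delta> c ?j ?E x)"
    by (rule shifted_cherednik_poly_cmult[OF rp])
  also have "\<dots> \<simeq> (\<lambda>x. ?d * ((\<delta> + a * (of_nat (idx ?j) - 1)) * (1 + of_real (x $ ?j)) * ?E x))"
    using cherednik_poly_plus_step[of _ a b \<iota> \<delta> ?j] by (simp add: reg_eq_def shifted_cherednik_poly_def c_def)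
  finally show ?case by (simp add: t st mult_ac)
qed

lemma foldr_minus:
  fixes a b \<iota> \<delta> :: complex
  defines "js \<equiv> sorted_list_of_set (UNIV :: 'n::{finite,linorder} set)"
    and "c \<equiv> \<delta> + rho a b \<iota> (Min (UNIV :: 'n set))"
    and "E \<equiv> \<lambda>x :: real ^ 'n::{finite,linorder}. \<Prod>j\<in>UNIV. 1 + complex_of_real (x $ j)"
  assumes "n \<le> CARD('n)"
  shows "foldr (shifted_cherednik_poly a b \<iota> \<delta> (- c)) (drop n js) E
    \<simeq> (\<lambda>x. (\<Prod>j\<in>set (drop n js). \<delta> - 1 + \<iota> + 2 * b + a * (of_nat CARD('n) - of_nat (idx j)))
      * ((\<Prod>j\<in>set (drop n js). of_real (x $ j) - 1) * E x))"
  using assms(4)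
\<comment> \<open>Downward induction on n: \<open>foldr\<close> applies the factor of the last index
  first, so the processed part is a suffix that grows to the left.\<close>
proof (induction rule: inc_induct)
  case base
  show ?case by (simp add: js_def reg_eq_refl)
next
  case (step n)
  let ?j = "js ! n" and ?d = "\<Prod>j\<in>set (drop (Suc n) js). \<delta> - 1 + \<iota> + 2 * b + a * (of_nat CARD('n) - of_nat (idx j))"
  have n: "n < CARD('n)" "n < length js" using step.hyps by (simp_all add: js_def)
  have t: "drop n js = ?j # drop (Suc n) js" using n by (simp add: Cons_nth_drop_Suc)
  have st: "set (drop (Suc n) js) = {?j<..}" using sorted_UNIV_nth[OF n(1)] by (simp add: js_def)
  let ?E = "\<lambda>x. (\<Prod>j\<in>{?j<..}. complex_of_real (x $ j) - 1) * E x"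
  have rp: "regpoly ?E" unfolding E_def by (intro polyf_regpoly polyf_intros)
  have "foldr (shifted_cherednik_poly a b \<iota> \<delta> (- c)) (drop n js) E \<simeq> shifted_cherednik_poly a b \<iota> \<delta> (- c) ?j (\<lambda>x. ?d * ?E x)"
    using step.IH by (simp add: t st shifted_cherednik_poly_cong)
  also have "\<dots> \<simeq> (\<lambda>x. ?d * shifted_cherednik_poly a b \<iota> \<delta> (- c) ?j ?E x)"
    by (rule shifted_cherednik_poly_cmult[OF rp])
  also have "\<dots> \<simeq> (\<lambda>x. ?d * ((\<delta> - 1 + \<iota> + 2 * b + a * (of_nat CARD('n) - of_nat (idx ?j)))
      * (of_real (x $ ?j) - 1) * ?E x))"
  proof -
    have "shifted_cherednik_poly a b \<iota> \<delta> (- c) ?j ?E x = (\<delta> - 1 + \<iota> + 2 * b + a * (of_nat CARD('n) - of_nat (idx ?j)))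
      * (of_real (x $ ?j) - 1) * ?E x" if "reg x" for x
      using cherednik_poly_minus_step[OF that, of a b \<iota> \<delta> ?j]
      unfolding shifted_cherednik_poly_def c_def E_def mult_minus_left diff_conv_add_uminus[symmetric] .
    then show ?thesis by (simp add: reg_eq_def)
  qed
  finally show ?case by (simp add: t st mult_ac)
qed

lemma foldr_M_poly_one:
  fixes a b \<iota> \<delta> :: complex
  shows "foldr (M_poly a b \<iota> \<delta> (\<delta> + rho a b \<iota> (Min (UNIV :: 'n::{finite,linorder} set))))
      (sorted_list_of_set (UNIV :: 'n set)) (\<lambda>x. 1)
    \<simeq> (\<lambda>x. m_const TYPE('n) a b \<iota> \<delta> * (\<Prod>j\<in>UNIV. (of_real (x $ j))\<^sup>2 - 1))"
proof -
  let ?js = "sorted_list_of_set (UNIV :: 'n set)" and ?c = "\<delta> + rho a b \<iota> (Min (UNIV :: 'n set))"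
  let ?E = "\<lambda>x :: real ^ 'n::{finite,linorder}. \<Prod>j\<in>UNIV. 1 + complex_of_real (x $ j)"
  let ?d = "\<Prod>j\<in>(UNIV :: 'n set). \<delta> + a * (of_nat (idx j) - 1)"
  have rp: "regpoly ?E" by (intro polyf_regpoly polyf_intros)
  have cm: "foldr (shifted_cherednik_poly a b \<iota> \<delta> (- ?c)) ks (\<lambda>x. ?d * ?E x) \<simeq> (\<lambda>x. ?d * foldr (shifted_cherednik_poly a b \<iota> \<delta> (- ?c)) ks ?E x)" for ks
  proof (induction ks)
    case (Cons k ks)
    from reg_eq_trans[OF shifted_cherednik_poly_cong[OF Cons] shifted_cherednik_poly_cmult[OF regpoly_foldr[OF rp]]] show ?case
      by simp
  qed (simp add: reg_eq_refl)
  have "foldr (M_poly a b \<iota> \<delta> ?c) ?js (\<lambda>x. 1)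
      \<simeq> foldr (shifted_cherednik_poly a b \<iota> \<delta> (- ?c)) ?js (foldr (shifted_cherednik_poly a b \<iota> \<delta> ?c) (rev ?js) (\<lambda>x. 1))"
    by (intro foldr_M_poly polyf_regpoly polyf_const)
  also have "\<dots> \<simeq> foldr (shifted_cherednik_poly a b \<iota> \<delta> (- ?c)) ?js (\<lambda>x. ?d * ?E x)"
    using foldr_plus[where 'n = 'n, OF order_refl, of a b \<iota> \<delta>] by (intro foldr_cong_reg_eq) simp
  also note cm
  also have "(\<lambda>x. ?d * foldr (shifted_cherednik_poly a b \<iota> \<delta> (- ?c)) ?js ?E x)
      \<simeq> (\<lambda>x. ?d * ((\<Prod>j\<in>(UNIV :: 'n set). \<delta> - 1 + \<iota> + 2 * b + a * (of_nat CARD('n) - of_nat (idx j)))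
        * ((\<Prod>j\<in>UNIV. of_real (x $ j) - 1) * ?E x)))"
    using foldr_minus[where 'n = 'n, of 0 a b \<iota> \<delta>] by (simp add: reg_eq_def)
  also have "\<dots> = (\<lambda>x. m_const TYPE('n) a b \<iota> \<delta> * (\<Prod>j\<in>UNIV. (of_real (x $ j))\<^sup>2 - 1))"
    by (simp add: m_const_def prod.distrib[symmetric] fun_eq_iff mult.assoc[symmetric])
      (simp add: prod.distrib[symmetric] algebra_simps power2_eq_square)
  finally show ?thesis .
qed

subsection \<open>Passage from polynomials in coth to functions on the original space\<close>

definition nonzero_coords :: "real ^ 'n::finite \<Rightarrow> bool"
  where "nonzero_coords t \<longleftrightarrow> (\<forall>j. t $ j \<noteq> 0)"

definition coth_vec :: "real ^ 'n::finite \<Rightarrow> real ^ 'n"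
  where "coth_vec t = (\<chi> j. cosh (t $ j) / sinh (t $ j))"

definition SH_powr :: "complex \<Rightarrow> real ^ 'n::finite \<Rightarrow> complex"
  where "SH_powr \<delta> t = complex_of_real \<bar>SH t\<bar> powr \<delta>"

lemma SH_nonzero: "nonzero_coords t \<Longrightarrow> SH t \<noteq> 0"
  by (simp add: nonzero_coords_def SH_def)

text \<open>Real \<open>ln\<close> satisfies ln (-x) = ln x, so no absolute value is needed. The
  right-hand side is differentiable on every chamber of signs at once.\<close>

lemma SH_powr_exp:
  assumes "SH t \<noteq> 0"
  shows "SH_powr \<delta> t = exp (\<delta> * of_real (ln (SH t)))"
proof -
  have "ln \<bar>SH t\<bar> = ln (SH t)" by (simp add: abs_real_def ln_minus)
  then show ?thesis using assms by (simp add: SH_powr_def powr_def Ln_of_real)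
qed

lemma nonzero_coords_refl: "nonzero_coords t \<Longrightarrow> nonzero_coords (swap i j t)" "nonzero_coords t \<Longrightarrow> nonzero_coords (neg_swap i j t)" "nonzero_coords t \<Longrightarrow> nonzero_coords (neg_coord j t)"
  by (auto simp: nonzero_coords_def refl_nth)

lemma coth_vec_refl: "coth_vec (swap i j t) = swap i j (coth_vec t)"
    "coth_vec (neg_swap i j t) = neg_swap i j (coth_vec t)" "coth_vec (neg_coord j t) = neg_coord j (coth_vec t)"
  by (auto simp: vec_eq_iff coth_vec_def refl_nth)

lemma abs_SH_signed_perm:
  assumes "bij p" "\<And>k. y $ k = x $ p k \<or> y $ k = - x $ p k"
  shows "\<bar>SH y\<bar> = \<bar>SH x\<bar>"
proof -
  have "\<bar>sinh (y $ k)\<bar> = \<bar>sinh (x $ p k)\<bar>" for k using assms(2)[of k] by auto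
  then have "\<bar>SH y\<bar> = (\<Prod>k\<in>UNIV. \<bar>sinh (x $ p k)\<bar>)" by (simp add: SH_def abs_prod)
  also have "\<dots> = (\<Prod>k\<in>UNIV. \<bar>sinh (x $ k)\<bar>)" using assms(1) by (rule prod.reindex_bij_betw)
  finally show ?thesis by (simp add: SH_def abs_prod)
qed

lemma SH_powr_refl: "SH_powr \<delta> (swap i j t) = SH_powr \<delta> t" "SH_powr \<delta> (neg_swap i j t) = SH_powr \<delta> t"
  "SH_powr \<delta> (neg_coord j t) = SH_powr \<delta> t"
proof -
  have "bij (\<lambda>k. if k = i then j else if k = j then i else k)"
    by (rule involuntory_imp_bij) auto
  then have "\<bar>SH (swap i j t)\<bar> = \<bar>SH t\<bar>" "\<bar>SH (neg_swap i j t)\<bar> = \<bar>SH t\<bar>"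
    by (rule abs_SH_signed_perm; simp add: refl_nth)+
  moreover have "\<bar>SH (neg_coord j t)\<bar> = \<bar>SH t\<bar>"
    by (rule abs_SH_signed_perm[OF bij_id]) (auto simp: refl_nth)
  ultimately show "SH_powr \<delta> (swap i j t) = SH_powr \<delta> t" "SH_powr \<delta> (neg_swap i j t) = SH_powr \<delta> t"
    "SH_powr \<delta> (neg_coord j t) = SH_powr \<delta> t" by (simp_all add: SH_powr_def)
qed

lemma open_nonzero_coords: "open {t :: real ^ 'n::finite. nonzero_coords t}"
proof -
  have "{t :: real ^ 'n. nonzero_coords t} = (\<Inter>j. {t. t $ j \<noteq> 0})" by (auto simp: nonzero_coords_def)
  then show ?thesis by (auto intro!: open_INT open_Collect_neq continuous_intros)
qed

lemma continuous_on_coth_vec: "continuous_on {t. nonzero_coords t} coth_vec"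
  unfolding coth_vec_def by (auto intro!: continuous_intros simp: nonzero_coords_def)

lemma continuous_on_SH_powr: "continuous_on {t. nonzero_coords t} (SH_powr \<delta>)"
proof -
  have "continuous_on {t :: real ^ 'a. nonzero_coords t} SH" unfolding SH_def by (intro continuous_intros)
  then have "continuous_on {t :: real ^ 'a. nonzero_coords t} (\<lambda>t. exp (\<delta> * of_real (ln (SH t))))"
    by (intro continuous_intros) (auto simp: SH_nonzero)
  then show ?thesis by (rule continuous_on_eq) (simp add: SH_powr_exp SH_nonzero)
qed

section \<open>Derivatives along coordinate lines in t\<close>

lemma polyf_line_derivative:
  assumes "polyf P" "nonzero_coords t"
  shows "((\<lambda>h. P (coth_vec (t + h *\<^sub>R axis j 1))) has_vector_derivative dx j P (coth_vec t)) (at 0)"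
  using assms(1)
proof induction
  case (polyf_const c)
  show ?case by (simp add: dx_const)
next
  case (polyf_coord i)
  show ?case
  proof (cases "i = j")
    case True
    have "sinh (t $ j) \<noteq> 0" using assms(2) by (simp add: nonzero_coords_def)
    then have "((\<lambda>h. cosh (t $ j + h) / sinh (t $ j + h)) has_real_derivative
        1 - (cosh (t $ j) / sinh (t $ j))\<^sup>2) (at 0)"
      by (auto intro!: derivative_eq_intros simp: field_simps power2_eq_square)
    then have "((\<lambda>h. complex_of_real (cosh (t $ j + h) / sinh (t $ j + h))) has_vector_derivative
        of_real (1 - (cosh (t $ j) / sinh (t $ j))\<^sup>2)) (at 0)"
      by (intro has_vector_derivative_of_real) (simp add: has_real_derivative_iff_has_vector_derivative)
    then show ?thesis using True by (simp add: dx_coord coth_vec_def axis_def)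
  next
    case False
    then show ?thesis by (simp add: dx_coord coth_vec_def axis_def)
  qed
next
  case (polyf_add P Q)
  then show ?case by (simp add: dx_add has_vector_derivative_add)
next
  case (polyf_mult P Q)
  show ?case
    using has_vector_derivative_mult[OF polyf_mult.IH] polyf_mult.hyps
    by (simp add: dx_mult add.commute)
qed

text \<open>For negative arguments this rests on ln (-x) = ln x again.\<close>

lemma DERIV_ln_nonzero:
  fixes x :: real
  assumes "x \<noteq> 0"
  shows "(ln has_real_derivative inverse x) (at x)"
proof (cases "0 < x")
  case False
  then have "((\<lambda>x. ln (- x)) has_real_derivative inverse x) (at x)"
    using assms by (auto intro!: derivative_eq_intros simp: field_simps)
  then show ?thesis by (simp add: ln_minus)
qed (rule DERIV_ln)

lemma SH_powr_line_derivative: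
  assumes "nonzero_coords t"
  shows "((\<lambda>h. SH_powr \<delta> (t + h *\<^sub>R axis j 1)) has_vector_derivative
    \<delta> * of_real (coth_vec t $ j) * SH_powr \<delta> t) (at 0)"
proof -
  define C where "C = (\<Prod>k\<in>UNIV - {j}. sinh (t $ k))"
  have C: "C \<noteq> 0" using assms by (simp add: C_def nonzero_coords_def)
  have SH: "SH (t + h *\<^sub>R axis j 1) = sinh (t $ j + h) * C" for h
    unfolding SH_def C_def by (subst prod.remove[of _ j]) (auto simp: axis_def intro!: prod.cong)
  have s: "sinh (t $ j) \<noteq> 0" using assms by (simp add: nonzero_coords_def)
  have "((\<lambda>h. ln (sinh (t $ j + h) * C)) has_real_derivative cosh (t $ j) / sinh (t $ j)) (at 0)"
  proof -
    have "((\<lambda>h. sinh (t $ j + h) * C) has_real_derivative cosh (t $ j) * C) (at 0)"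
      by (auto intro!: derivative_eq_intros)
    from DERIV_chain2[OF DERIV_ln_nonzero this] s C show ?thesis by (simp add: field_simps)
  qed
  then have "((\<lambda>h. complex_of_real (ln (SH (t + h *\<^sub>R axis j 1)))) has_vector_derivative
      of_real (coth_vec t $ j)) (at 0)"
    unfolding SH by (intro has_vector_derivative_of_real)
      (simp add: has_real_derivative_iff_has_vector_derivative coth_vec_def)
  from has_vector_derivative_mult_right[OF this, of \<delta>]
  have "((\<lambda>h. exp (\<delta> * of_real (ln (SH (t + h *\<^sub>R axis j 1))))) has_vector_derivative
      \<delta> * of_real (coth_vec t $ j) * exp (\<delta> * of_real (ln (SH t)))) (at 0)"
    using field_vector_diff_chain_at[OF _ DERIV_exp] by (fastforce simp: o_def)
  then have "((\<lambda>h. exp (\<delta> * of_real (ln (SH (t + h *\<^sub>R axis j 1))))) has_vector_derivative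
      \<delta> * of_real (coth_vec t $ j) * SH_powr \<delta> t) (at 0)"
    by (simp add: SH_powr_exp SH_nonzero assms)
  then show ?thesis
  proof (rule has_vector_derivative_transform_within_open[where S = "{h. t $ j + h \<noteq> 0}"])
    show "open {h. t $ j + h \<noteq> 0}" by (intro open_Collect_neq continuous_intros)
    show "0 \<in> {h. t $ j + h \<noteq> 0}" using assms by (simp add: nonzero_coords_def)
    show "exp (\<delta> * of_real (ln (SH (t + h *\<^sub>R axis j 1)))) = SH_powr \<delta> (t + h *\<^sub>R axis j 1)"
      if "h \<in> {h. t $ j + h \<noteq> 0}" for h
      using that C by (simp add: SH_powr_exp SH)
  qed
qed

text \<open>\<open>g\<close> is the polynomial P in coth t times |SH|^\<delta>. The equation is
  required also on t_i = t_j and t_i = -t_j, so \<open>g\<close> is controlled at all points where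
  the next operator evaluates it or takes limits.\<close>

definition rep :: "complex \<Rightarrow> (real ^ 'n::finite \<Rightarrow> complex) \<Rightarrow> (real ^ 'n \<Rightarrow> complex) \<Rightarrow> bool"
  where "rep \<delta> P g \<longleftrightarrow> polyf P \<and> (\<forall>t. nonzero_coords t \<longrightarrow> g t = P (coth_vec t) * SH_powr \<delta> t)"

lemma partial_rep:
  assumes "rep \<delta> P g" "nonzero_coords t"
  shows "partial j g t = deriv_op \<delta> j P (coth_vec t) * SH_powr \<delta> t"
proof -
  have P: "polyf P" and g: "\<And>t. nonzero_coords t \<Longrightarrow> g t = P (coth_vec t) * SH_powr \<delta> t"
    using assms(1) by (auto simp: rep_def)
  have "((\<lambda>h. P (coth_vec (t + h *\<^sub>R axis j 1)) * SH_powr \<delta> (t + h *\<^sub>R axis j 1)) has_vector_derivative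
      deriv_op \<delta> j P (coth_vec t) * SH_powr \<delta> t) (at 0)"
    using has_vector_derivative_mult[OF polyf_line_derivative[OF P assms(2)] SH_powr_line_derivative[OF assms(2)]]
    by (simp add: deriv_op_def algebra_simps)
  then have "((\<lambda>h. g (t + h *\<^sub>R axis j 1)) has_vector_derivative deriv_op \<delta> j P (coth_vec t) * SH_powr \<delta> t) (at 0)"
  proof (rule has_vector_derivative_transform_within_open[where S = "{h. t $ j + h \<noteq> 0}"])
    show "open {h. t $ j + h \<noteq> 0}" by (intro open_Collect_neq continuous_intros)
    show "0 \<in> {h. t $ j + h \<noteq> 0}" using assms by (simp add: nonzero_coords_def)
    fix h assume "h \<in> {h. t $ j + h \<noteq> 0}"
    then have "nonzero_coords (t + h *\<^sub>R axis j 1)" using assms(2) by (auto simp: nonzero_coords_def axis_def)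
    then show "P (coth_vec (t + h *\<^sub>R axis j 1)) * SH_powr \<delta> (t + h *\<^sub>R axis j 1) = g (t + h *\<^sub>R axis j 1)"
      by (simp add: g)
  qed
  then show ?thesis unfolding partial_def by (rule vector_derivative_at)
qed

text \<open>The hypothesis on \<phi> says that 1/(1 - e^(-\<phi>)) equals K / l, without
  denominators so that it covers \<phi> = 0. Off that hyperplane the quotient is computed from l Q =
  K (P - P o w); on it, \<open>Lim\<close> returns the value of the continuous function Q(coth t)
  |SH|^\<delta>.\<close>

lemma quot_rep:
  fixes w :: "real ^ 'n::finite \<Rightarrow> real ^ 'n" and v :: "real ^ 'n" and d :: real
  assumes h: "refl_data c w l K" and r: "rep \<delta> P g" and Q: "polyf Q" "Q \<simeq> refl_op c w P"
    and w: "\<And>u. nonzero_coords u \<Longrightarrow> nonzero_coords (w u)" "\<And>u. coth_vec (w u) = w (coth_vec u)" "\<And>u. SH_powr \<delta> (w u) = SH_powr \<delta> u"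
    and K: "\<And>u. nonzero_coords u \<Longrightarrow> K (coth_vec u) \<noteq> 0"
    and \<phi>: "\<And>u. nonzero_coords u \<Longrightarrow> K (coth_vec u) * of_real (1 - exp (- \<phi> u)) = of_real (l (coth_vec u))"
    and linear_op: "\<And>u h. \<phi> (u + h *\<^sub>R v) = \<phi> u + h * d" "d \<noteq> 0"
    and t: "nonzero_coords t"
  shows "quot w \<phi> g t = Q (coth_vec t) * SH_powr \<delta> t"
proof -
  have P: "polyf P" and g: "\<And>t. nonzero_coords t \<Longrightarrow> g t = P (coth_vec t) * SH_powr \<delta> t"
    using r by (auto simp: rep_def)
  obtain Q' where Q': "polyf Q'" "\<And>x. reg x \<Longrightarrow> refl_op c w P x = Q' x"
    "\<And>x. of_real (l x) * Q' x = K x * (P x - P (w x))"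
    using refl_op_polyf_extension[OF h P] by metis
  \<comment> \<open>\<open>Q\<close> is known at regular points only, \<open>Q'\<close> satisfies l
    Q' = K (P - P o w) everywhere. By density they coincide, so the equation is available for
    \<open>Q\<close> at every point.\<close>
  have "Q = Q'" using Q Q' by (intro polyf_eqI) (auto simp: reg_eq_def)
  define q where "q = (\<lambda>u. (g u - g (w u)) / complex_of_real (1 - exp (- \<phi> u)))"
  have q: "q u = Q (coth_vec u) * SH_powr \<delta> u" if u: "nonzero_coords u" "\<phi> u \<noteq> 0" for u
  proof -
    let ?e = "complex_of_real (1 - exp (- \<phi> u))"
    have e: "?e \<noteq> 0" using u(2) by (simp del: of_real_diff)
    have "K (coth_vec u) * ?e * Q (coth_vec u) = K (coth_vec u) * (P (coth_vec u) - P (w (coth_vec u)))"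
      using Q'(3)[of "coth_vec u"] unfolding \<phi>[OF u(1)] \<open>Q = Q'\<close> .
    then have "P (coth_vec u) - P (w (coth_vec u)) = ?e * Q (coth_vec u)"
      using K[OF u(1)] by (simp add: mult.assoc)
    then have "g u - g (w u) = ?e * (Q (coth_vec u) * SH_powr \<delta> u)"
      by (simp add: g u w left_diff_distrib[symmetric])
    then show ?thesis using e by (simp add: q_def)
  qed
  show ?thesis
  proof (cases "\<phi> t = 0")
    case False
    then show ?thesis using q[OF t] by (simp add: quot_def q_def Let_def)
  next
    case True
    let ?F = "at t within {u. \<phi> u \<noteq> 0}"
    \<comment> \<open>\<open>Lim\<close> is determined only for a nontrivial filter. Moving
      \<open>t\<close> along \<open>v\<close>, on which \<phi> is not constant, leaves the
      hyperplane at once.\<close>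
    have "t islimpt {u. \<phi> u \<noteq> 0}"
      unfolding islimpt_approachable
    proof (intro allI impI)
      fix e :: real assume e: "e > 0"
      define h where "h = e / (2 * (norm v + 1))"
      have "v \<noteq> 0" using linear_op(1)[of 0 1] linear_op by auto
      have "h > 0" "h * norm v < e" using e by (auto simp: h_def field_simps add_strict_increasing)
      then have "\<phi> (t + h *\<^sub>R v) \<noteq> 0" "dist (t + h *\<^sub>R v) t < e" "t + h *\<^sub>R v \<noteq> t"
        using linear_op True \<open>v \<noteq> 0\<close> by (auto simp: dist_norm)
      then show "\<exists>x'\<in>{u. \<phi> u \<noteq> 0}. x' \<noteq> t \<and> dist x' t < e" by blast
    qed
    then have nt: "\<not> trivial_limit ?F" by (simp add: trivial_limit_within)
    have "continuous_on {t. nonzero_coords t} (\<lambda>u. Q (coth_vec u) * SH_powr \<delta> u)"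
      by (intro continuous_intros continuous_on_SH_powr continuous_on_compose2[OF continuous_polyf[OF Q(1), of UNIV]]
          continuous_on_coth_vec) simp
    then have "isCont (\<lambda>u. Q (coth_vec u) * SH_powr \<delta> u) t"
      using t by (simp add: continuous_on_eq_continuous_at[OF open_nonzero_coords])
    then have "((\<lambda>u. Q (coth_vec u) * SH_powr \<delta> u) \<longlongrightarrow> Q (coth_vec t) * SH_powr \<delta> t) ?F"
      using continuous_at_imp_continuous_at_within continuous_within by blast
    moreover have "\<forall>\<^sub>F u in ?F. Q (coth_vec u) * SH_powr \<delta> u = q u"
    proof -
      have "\<forall>\<^sub>F u in ?F. nonzero_coords u"
      proof -
        have "\<forall>\<^sub>F u in nhds t. nonzero_coords u" using eventually_nhds_in_open[OF open_nonzero_coords, of t] t by simp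
        then show ?thesis unfolding eventually_at_filter by (rule eventually_mono) simp
      qed
      moreover have "\<forall>\<^sub>F u in ?F. \<phi> u \<noteq> 0" by (auto simp: eventually_at_filter)
      ultimately show ?thesis by eventually_elim (simp add: q)
    qed
    ultimately have "(q \<longlongrightarrow> Q (coth_vec t) * SH_powr \<delta> t) ?F" by (rule Lim_transform_eventually)
    then show ?thesis using True tendsto_Lim[OF nt] by (simp add: quot_def q_def Let_def)
  qed
qed

section \<open>Hyperbolic identities and the four kinds of quotients\<close>

lemma one_plus_coth:
  fixes u :: real
  assumes "u \<noteq> 0"
  shows "1 + cosh u / sinh u = exp u / sinh u" "1 - cosh u / sinh u = - exp (- u) / sinh u"
  using assms sinh_plus_cosh[of u] cosh_minus_sinh[of u] by (simp_all add: field_simps)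

text \<open>This identifies \<open>long_coeff\<close> at coth u and coth v with 1/(1 - e^(-2(u -
  v))), cleared of denominators. It follows from 1 + coth u = e^u / sinh u, 1 - coth v = -e^(-v) /
  sinh v and the addition formula for sinh.\<close>

lemma coth_difference:
  fixes u v :: real
  assumes "u \<noteq> 0" "v \<noteq> 0"
  shows "1 / 2 * ((1 + cosh u / sinh u) * (1 - cosh v / sinh v)) * (1 - exp (- (2 * (u - v))))
    = cosh u / sinh u - cosh v / sinh v"
proof -
  have "exp u * exp (- v) * (1 - exp (- (2 * (u - v)))) = exp (u - v) - exp (- (u - v))"
    by (simp add: right_diff_distrib flip: exp_add)
  also have "\<dots> = 2 * sinh (u - v)" by (simp add: sinh_field_def)
  finally have "exp u * exp (- v) * (1 - exp (- (2 * (u - v)))) = 2 * (sinh u * cosh v - cosh u * sinh v)"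
    by (simp add: sinh_diff)
  note main = this
  have "1 / 2 * ((1 + cosh u / sinh u) * (1 - cosh v / sinh v)) * (1 - exp (- (2 * (u - v))))
      = - (exp u * exp (- v) * (1 - exp (- (2 * (u - v))))) / (2 * sinh u * sinh v)"
    unfolding one_plus_coth[OF assms(1)] one_plus_coth[OF assms(2)] by simp
  also have "\<dots> = cosh u / sinh u - cosh v / sinh v"
    unfolding main using assms by (simp add: field_simps)
  finally show ?thesis .
qed

lemma one_plus_coth_nonzero:
  fixes u :: real
  assumes "u \<noteq> 0"
  shows "1 + complex_of_real (cosh u / sinh u) \<noteq> 0" "1 - complex_of_real (cosh u / sinh u) \<noteq> 0"
proof -
  have "1 + cosh u / sinh u \<noteq> 0" "1 - cosh u / sinh u \<noteq> 0"
    unfolding one_plus_coth[OF assms] using assms by simp_all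
  then have "complex_of_real (1 + cosh u / sinh u) \<noteq> 0" "complex_of_real (1 - cosh u / sinh u) \<noteq> 0"
    by (simp_all only: of_real_eq_0_iff not_False_eq_True)
  then show "1 + complex_of_real (cosh u / sinh u) \<noteq> 0" "1 - complex_of_real (cosh u / sinh u) \<noteq> 0"
    by (simp_all only: of_real_add of_real_diff of_real_1 not_False_eq_True)
qed

lemma quot_swap_rep:
  assumes ij: "i \<noteq> j" and r: "rep \<delta> P g" and Q: "polyf Q" "Q \<simeq> T_minus i j P" and t: "nonzero_coords t"
  shows "quot (swap i j) (\<lambda>u. 2 * (u $ i - u $ j)) g t = Q (coth_vec t) * SH_powr \<delta> t"
proof (rule quot_rep[OF refl_data_T_minus[OF ij] r Q[unfolded T_minus_def] nonzero_coords_refl(1) coth_vec_refl(1) SH_powr_refl(1) _ _ _ _ t])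
  fix u :: "real ^ 'a" assume u: "nonzero_coords u"
  then have u: "u $ i \<noteq> 0" "u $ j \<noteq> 0" by (auto simp: nonzero_coords_def)
  show "1 / 2 * ((1 + complex_of_real (coth_vec u $ i)) * (1 - of_real (coth_vec u $ j))) \<noteq> 0"
    using one_plus_coth_nonzero[OF u(1)] one_plus_coth_nonzero[OF u(2)] by (simp add: coth_vec_def)
  show "1 / 2 * ((1 + complex_of_real (coth_vec u $ i)) * (1 - of_real (coth_vec u $ j)))
      * of_real (1 - exp (- (2 * (u $ i - u $ j)))) = of_real (coth_vec u $ i - coth_vec u $ j)"
    using arg_cong[OF coth_difference[OF u], of complex_of_real] by (simp add: coth_vec_def)
next
  show "2 * ((u + h *\<^sub>R axis i 1) $ i - (u + h *\<^sub>R axis i 1) $ j) = 2 * (u $ i - u $ j) + h * 2" for u h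
    using ij by (simp add: axis_def)
next
  show "(2 :: real) \<noteq> 0" by simp
qed

lemma quot_neg_swap_rep:
  assumes ij: "i \<noteq> j" and r: "rep \<delta> P g" and Q: "polyf Q" "Q \<simeq> T_plus i j P" and t: "nonzero_coords t"
  shows "quot (neg_swap i j) (\<lambda>u. 2 * (u $ i + u $ j)) g t = Q (coth_vec t) * SH_powr \<delta> t"
proof (rule quot_rep[OF refl_data_T_plus[OF ij] r Q[unfolded T_plus_def] nonzero_coords_refl(2) coth_vec_refl(2) SH_powr_refl(2) _ _ _ _ t])
  fix u :: "real ^ 'a" assume u: "nonzero_coords u"
  then have u: "u $ i \<noteq> 0" "u $ j \<noteq> 0" "- u $ j \<noteq> 0" by (auto simp: nonzero_coords_def)
  show "1 / 2 * ((1 + complex_of_real (coth_vec u $ i)) * (1 + of_real (coth_vec u $ j))) \<noteq> 0"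
    using one_plus_coth_nonzero[OF u(1)] one_plus_coth_nonzero[OF u(2)] by (simp add: coth_vec_def)
  show "1 / 2 * ((1 + complex_of_real (coth_vec u $ i)) * (1 + of_real (coth_vec u $ j)))
      * of_real (1 - exp (- (2 * (u $ i + u $ j)))) = of_real (coth_vec u $ i + coth_vec u $ j)"
    \<comment> \<open>Taken at u_i and -u_j, since coth is odd.\<close>
    using arg_cong[OF coth_difference[OF u(1,3)], of complex_of_real] by (simp add: coth_vec_def)
next
  show "2 * ((u + h *\<^sub>R axis i 1) $ i + (u + h *\<^sub>R axis i 1) $ j) = 2 * (u $ i + u $ j) + h * 2" for u h
    using ij by (simp add: axis_def)
next
  show "(2 :: real) \<noteq> 0" by simp
qed

text \<open>The parameters 0 and 1/2 are chosen because \<open>short_coeff 0 (1 / 2)\<close> is (1 +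
  u)^2 / (4u), which at u = coth s equals 1/(1 - e^(-4s)).\<close>

lemma quot_neg_coord_rep4:
  assumes r: "rep \<delta> P g" and Q: "polyf Q" "Q \<simeq> T_short 0 (1 / 2) j P" and t: "nonzero_coords t"
  shows "quot (neg_coord j) (\<lambda>u. 4 * u $ j) g t = Q (coth_vec t) * SH_powr \<delta> t"
proof (rule quot_rep[OF refl_data_T_short r Q[unfolded T_short_def] nonzero_coords_refl(3) coth_vec_refl(3) SH_powr_refl(3) _ _ _ _ t])
  fix u :: "real ^ 'a" assume u: "nonzero_coords u"
  then have u: "u $ j \<noteq> 0" "- u $ j \<noteq> 0" by (auto simp: nonzero_coords_def)
  show "1 / 2 / 2 * (1 + complex_of_real (coth_vec u $ j))\<^sup>2
      + 0 * (of_real (coth_vec u $ j) * (1 + of_real (coth_vec u $ j))) \<noteq> 0"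
    using one_plus_coth_nonzero[OF u(1)] by (simp add: coth_vec_def)
  show "(1 / 2 / 2 * (1 + complex_of_real (coth_vec u $ j))\<^sup>2
      + 0 * (of_real (coth_vec u $ j) * (1 + of_real (coth_vec u $ j))))
      * of_real (1 - exp (- (4 * u $ j))) = of_real (coth_vec u $ j)"
    using arg_cong[OF coth_difference[OF u], of "\<lambda>z. complex_of_real z / 2"]
    by (simp add: coth_vec_def power2_eq_square)
next
  show "4 * (u + h *\<^sub>R axis j 1) $ j = 4 * u $ j + h * 4" for u h
    by (simp add: axis_def)
next
  show "(4 :: real) \<noteq> 0" by simp
qed

text \<open>Here \<open>short_coeff (1 / 2) 0\<close> is (1 + u) / 2, which at u = coth s equals
  1/(1 - e^(-2s)).\<close>

lemma quot_neg_coord_rep2: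
  assumes r: "rep \<delta> P g" and Q: "polyf Q" "Q \<simeq> T_short (1 / 2) 0 j P" and t: "nonzero_coords t"
  shows "quot (neg_coord j) (\<lambda>u. 2 * u $ j) g t = Q (coth_vec t) * SH_powr \<delta> t"
proof (rule quot_rep[OF refl_data_T_short r Q[unfolded T_short_def] nonzero_coords_refl(3) coth_vec_refl(3) SH_powr_refl(3) _ _ _ _ t])
  fix u :: "real ^ 'a" assume u: "nonzero_coords u"
  then have u: "u $ j \<noteq> 0" by (auto simp: nonzero_coords_def)
  show "0 / 2 * (1 + complex_of_real (coth_vec u $ j))\<^sup>2
      + 1 / 2 * (of_real (coth_vec u $ j) * (1 + of_real (coth_vec u $ j))) \<noteq> 0"
    using one_plus_coth_nonzero[OF u] u by (simp add: coth_vec_def)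
  have "exp (u $ j) * (1 - exp (- (2 * u $ j))) = exp (u $ j) - exp (- u $ j)"
    by (simp add: right_diff_distrib flip: exp_add)
  also have "\<dots> = 2 * sinh (u $ j)" by (simp add: sinh_field_def)
  finally have "(1 + cosh (u $ j) / sinh (u $ j)) * (1 - exp (- (2 * u $ j))) = 2"
    unfolding one_plus_coth[OF u] using u by (simp add: field_simps)
  \<comment> \<open>The extra factor coth is there because the data for \<open>T_short\<close> use l
    = x_j, so that K also carries a factor x_j.\<close>
  from arg_cong[OF this, of "\<lambda>z. complex_of_real (cosh (u $ j) / sinh (u $ j) * z / 2)"]
  show "(0 / 2 * (1 + complex_of_real (coth_vec u $ j))\<^sup>2
      + 1 / 2 * (of_real (coth_vec u $ j) * (1 + of_real (coth_vec u $ j))))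
      * of_real (1 - exp (- (2 * u $ j))) = of_real (coth_vec u $ j)"
    by (simp add: coth_vec_def mult_ac)
next
  show "2 * (u + h *\<^sub>R axis j 1) $ j = 2 * u $ j + h * 2" for u h
    by (simp add: axis_def)
next
  show "(2 :: real) \<noteq> 0" by simp
qed

lemma T_short_split: "T_short b \<iota> j P x = 2 * \<iota> * T_short 0 (1 / 2) j P x + 2 * b * T_short (1 / 2) 0 j P x"
proof -
  have "short_coeff b \<iota> u = 2 * \<iota> * short_coeff 0 (1 / 2) u + 2 * b * short_coeff (1 / 2) 0 u" for u
    by (simp add: short_coeff_def)
  then show ?thesis unfolding T_short_def refl_op_def by (simp only: distrib_right mult.assoc)
qed

lemma regpoly_extension: "regpoly G \<Longrightarrow> \<exists>Q. polyf Q \<and> Q \<simeq> G"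
  by (auto simp: regpoly_def reg_eq_def)

text \<open>The class of functions P(coth t) |SH|^\<delta> is stable under D_j, including the values
  defined as limits. This is what permits applying the operators repeatedly.\<close>

lemma cherednik_rep:
  fixes P :: "real ^ 'n::{finite,linorder} \<Rightarrow> complex"
  assumes r: "rep \<delta> P g"
  shows "\<exists>Q. rep \<delta> Q (cherednik a b \<iota> j g) \<and> Q \<simeq> cherednik_poly a b \<iota> \<delta> j P"
proof -
  have P: "polyf P" and g: "\<And>t. nonzero_coords t \<Longrightarrow> g t = P (coth_vec t) * SH_powr \<delta> t"
    using r by (auto simp: rep_def)
  note rp = polyf_regpoly[OF P]
  \<comment> \<open>Polynomial extensions are chosen for all pairs simultaneously, so that the sums
    over indices in \<open>Q\<close> below are polynomials.\<close>
  have "\<forall>i k. \<exists>Q. i \<noteq> k \<longrightarrow> polyf Q \<and> Q \<simeq> T_minus i k P"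
    using regpoly_extension[OF regpoly_T(1)[OF rp]] by blast
  then obtain Qm where Qm: "\<And>i k. i \<noteq> k \<Longrightarrow> polyf (Qm i k)" "\<And>i k. i \<noteq> k \<Longrightarrow> Qm i k \<simeq> T_minus i k P"
    by metis
  have "\<forall>i k. \<exists>Q. i \<noteq> k \<longrightarrow> polyf Q \<and> Q \<simeq> T_plus i k P"
    using regpoly_extension[OF regpoly_T(2)[OF rp]] by blast
  then obtain Qp where Qp: "\<And>i k. i \<noteq> k \<Longrightarrow> polyf (Qp i k)" "\<And>i k. i \<noteq> k \<Longrightarrow> Qp i k \<simeq> T_plus i k P"
    by metis
  obtain Q4 where Q4: "polyf Q4" "Q4 \<simeq> T_short 0 (1 / 2) j P"
    using regpoly_extension[OF regpoly_T(3)[OF rp]] by blast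
  obtain Q2 where Q2: "polyf Q2" "Q2 \<simeq> T_short (1 / 2) 0 j P"
    using regpoly_extension[OF regpoly_T(3)[OF rp]] by blast
  define Q where "Q = (\<lambda>x. deriv_op \<delta> j P x - a * (\<Sum>i | i < j. Qm i j x) + a * (\<Sum>k | j < k. Qm j k x)
    + a * (\<Sum>k | k \<noteq> j. Qp j k x) + 2 * \<iota> * Q4 x + 2 * b * Q2 x - rho a b \<iota> j * P x)"
  have "polyf Q"
    unfolding Q_def
    by (intro polyf_add polyf_diff polyf_mult polyf_const polyf_sum polyf_deriv_op P Q4 Q2 Qm Qp) auto
  moreover have "cherednik a b \<iota> j g t = Q (coth_vec t) * SH_powr \<delta> t" if t: "nonzero_coords t" for t
  proof -
    have "(\<Sum>i | i < j. quot (swap i j) (\<lambda>u. 2 * (u $ i - u $ j)) g t) = (\<Sum>i | i < j. Qm i j (coth_vec t)) * SH_powr \<delta> t"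
      unfolding sum_distrib_right by (intro sum.cong refl quot_swap_rep[OF _ r] Qm t) auto
    moreover have "(\<Sum>k | j < k. quot (swap j k) (\<lambda>u. 2 * (u $ j - u $ k)) g t) = (\<Sum>k | j < k. Qm j k (coth_vec t)) * SH_powr \<delta> t"
      unfolding sum_distrib_right by (intro sum.cong refl quot_swap_rep[OF _ r] Qm t) auto
    moreover have "(\<Sum>k | k \<noteq> j. quot (neg_swap j k) (\<lambda>u. 2 * (u $ j + u $ k)) g t) = (\<Sum>k | k \<noteq> j. Qp j k (coth_vec t)) * SH_powr \<delta> t"
      unfolding sum_distrib_right by (intro sum.cong refl quot_neg_swap_rep[OF _ r] Qp t) auto
    ultimately show ?thesis
      unfolding cherednik_def Q_def quot_neg_coord_rep4[OF r Q4 t] quot_neg_coord_rep2[OF r Q2 t]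
        partial_rep[OF r t] g[OF t]
      by (simp add: algebra_simps)
  qed
  moreover have "Q x = cherednik_poly a b \<iota> \<delta> j P x" if x: "reg x" for x
  proof -
    have "(\<Sum>k\<in>UNIV - {j}. T_pair j k P x)
        = (\<Sum>k\<in>UNIV - {j}. if j < k then T_minus j k P x else - T_minus k j P x) + (\<Sum>k\<in>UNIV - {j}. T_plus j k P x)"
      unfolding T_pair_def sum.distrib ..
    also have "(\<Sum>k\<in>UNIV - {j}. if j < k then T_minus j k P x else - T_minus k j P x)
        = (\<Sum>k | j < k. T_minus j k P x) - (\<Sum>k | k < j. T_minus k j P x)"
    proof -
      have U: "UNIV - {j} = {k. j < k} \<union> {k. k < j}" by auto
      have "(\<Sum>k\<in>UNIV - {j}. if j < k then T_minus j k P x else - T_minus k j P x)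
        = (\<Sum>k | j < k. if j < k then T_minus j k P x else - T_minus k j P x)
          + (\<Sum>k | k < j. if j < k then T_minus j k P x else - T_minus k j P x)"
        unfolding U by (rule sum.union_disjoint) auto
      also have "(\<Sum>k | j < k. if j < k then T_minus j k P x else - T_minus k j P x) = (\<Sum>k | j < k. T_minus j k P x)"
        by (rule sum.cong) auto
      also have "(\<Sum>k | k < j. if j < k then T_minus j k P x else - T_minus k j P x) = (\<Sum>k | k < j. - T_minus k j P x)"
        by (rule sum.cong) auto
      finally show ?thesis by (simp add: sum_negf)
    qed
    also have "(\<Sum>k | j < k. T_minus j k P x) = (\<Sum>k | j < k. Qm j k x)"
      using Qm(2) x by (intro sum.cong) (auto simp: reg_eq_def)
    also have "(\<Sum>k | k < j. T_minus k j P x) = (\<Sum>k | k < j. Qm k j x)"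
      using Qm(2) x by (intro sum.cong) (auto simp: reg_eq_def)
    also have "(\<Sum>k\<in>UNIV - {j}. T_plus j k P x) = (\<Sum>k | k \<noteq> j. Qp j k x)"
      using Qp(2) x by (intro sum.cong) (auto simp: reg_eq_def)
    finally have S: "(\<Sum>k\<in>UNIV - {j}. T_pair j k P x)
      = (\<Sum>k | j < k. Qm j k x) - (\<Sum>k | k < j. Qm k j x) + (\<Sum>k | k \<noteq> j. Qp j k x)" .
    show ?thesis
      using Q4(2) Q2(2) x
      by (simp add: Q_def cherednik_poly_def T_total_def S T_short_split[of b \<iota>] reg_eq_def algebra_simps)
  qed
  ultimately show ?thesis unfolding rep_def reg_eq_def by blast
qed

text \<open>\<open>G\<close> stands for the iterates of \<open>M_poly\<close>, which are wrong on
  the hyperplanes; the polynomial \<open>P\<close> agrees with \<open>G\<close> off them and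
  represents \<open>g\<close> everywhere needed.\<close>

lemma M_factor_rep:
  fixes P :: "real ^ 'n::{finite,linorder} \<Rightarrow> complex"
  assumes r: "rep \<delta> P g" and e: "P \<simeq> G"
  shows "\<exists>Q. rep \<delta> Q (M_factor a b \<iota> \<delta> j g) \<and>
    Q \<simeq> M_poly a b \<iota> \<delta> (\<delta> + rho a b \<iota> (Min (UNIV :: 'n set))) j G"
proof -
  let ?c = "\<delta> + rho a b \<iota> (Min (UNIV :: 'n set))"
  obtain P1 where P1: "rep \<delta> P1 (cherednik a b \<iota> j g)" "P1 \<simeq> cherednik_poly a b \<iota> \<delta> j P"
    using cherednik_rep[OF r] by blast
  obtain P2 where P2: "rep \<delta> P2 (cherednik a b \<iota> j (cherednik a b \<iota> j g))" "P2 \<simeq> cherednik_poly a b \<iota> \<delta> j P1"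
    using cherednik_rep[OF P1(1)] by blast
  define Q where "Q = (\<lambda>x. P2 x - ?c\<^sup>2 * P x)"
  have "polyf Q" unfolding Q_def using r P2(1)
    by (intro polyf_diff polyf_mult polyf_const) (auto simp: rep_def)
  then have "rep \<delta> Q (M_factor a b \<iota> \<delta> j g)"
    using r P2(1) by (simp add: rep_def M_factor_def Q_def algebra_simps)
  moreover have "Q \<simeq> M_poly a b \<iota> \<delta> ?c j P"
    using P2(2) P1(2) cherednik_poly_cong_reg[of P1 "cherednik_poly a b \<iota> \<delta> j P"]
    by (simp add: reg_eq_def Q_def M_poly_def)
  ultimately show ?thesis using reg_eq_trans[OF _ M_poly_cong[OF e]] by blast
qed

lemma M_op_rep:
  fixes P :: "real ^ 'n::{finite,linorder} \<Rightarrow> complex"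
  assumes "rep \<delta> P g"
  shows "\<exists>Q. rep \<delta> Q (foldr (M_factor a b \<iota> \<delta>) js g) \<and>
    Q \<simeq> foldr (M_poly a b \<iota> \<delta> (\<delta> + rho a b \<iota> (Min (UNIV :: 'n set)))) js P"
proof (induction js)
  case Nil
  then show ?case using assms reg_eq_refl by auto
next
  case (Cons j js)
  then show ?case using M_factor_rep by fastforce
qed

lemma SH_powr_coth:
  assumes "nonzero_coords t"
  shows "(\<Prod>j\<in>UNIV. (complex_of_real (coth_vec t $ j))\<^sup>2 - 1) * SH_powr \<delta> t = SH_powr (\<delta> - 2) t"
proof -
  have "(complex_of_real (coth_vec t $ j))\<^sup>2 - 1 = of_real (1 / (sinh (t $ j))\<^sup>2)" for j
  proof -
    have "sinh (t $ j) \<noteq> 0" using assms by (simp add: nonzero_coords_def)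
    then have "(coth_vec t $ j)\<^sup>2 - 1 = 1 / (sinh (t $ j))\<^sup>2"
      by (simp add: coth_vec_def power_divide cosh_square_eq add_divide_distrib)
    then show ?thesis by (metis of_real_1 of_real_diff of_real_power)
  qed
  then have "(\<Prod>j\<in>UNIV. (complex_of_real (coth_vec t $ j))\<^sup>2 - 1) = of_real (1 / (SH t)\<^sup>2)"
    by (simp add: SH_def prod_dividef prod_power_distrib)
  moreover have "SH_powr (\<delta> - 2) t = SH_powr \<delta> t / complex_of_real \<bar>SH t\<bar> powr of_nat 2"
    by (simp add: SH_powr_def powr_diff)
  moreover have "complex_of_real \<bar>SH t\<bar> powr of_nat 2 = of_real ((SH t)\<^sup>2)"
    by (subst powr_nat') (simp_all flip: of_real_power)
  ultimately show ?thesis by simp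
qed

theorem theorem3p1:
  fixes a b \<iota> \<delta> :: complex and t :: "real ^ 'n::{finite,linorder}"
  assumes "\<And>j. t $ j \<noteq> 0"
  shows "M_op a b \<iota> \<delta> (\<lambda>u. complex_of_real \<bar>SH u\<bar> powr \<delta>) t
    = m_const TYPE('n) a b \<iota> \<delta> * complex_of_real \<bar>SH t\<bar> powr (\<delta> - 2)"
proof -
  have t: "nonzero_coords t" using assms by (simp add: nonzero_coords_def)
  have "rep \<delta> (\<lambda>x :: real ^ 'n::{finite,linorder}. 1) (\<lambda>u. complex_of_real \<bar>SH u\<bar> powr \<delta>)"
    by (simp add: rep_def polyf_const SH_powr_def)
  from M_op_rep[OF this, of a b \<iota> "sorted_list_of_set UNIV"]
  obtain Q :: "real ^ 'n::{finite,linorder} \<Rightarrow> complex" where Q: "rep \<delta> Q (M_op a b \<iota> \<delta> (\<lambda>u. complex_of_real \<bar>SH u\<bar> powr \<delta>))"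
    "Q \<simeq> foldr (M_poly a b \<iota> \<delta> (\<delta> + rho a b \<iota> (Min (UNIV :: 'n set)))) (sorted_list_of_set UNIV) (\<lambda>x. 1)"
    by (auto simp: M_op_def)
  \<comment> \<open>The evaluation is known at regular points only. Equality of the two polynomials
    carries it to points t with t_i = t_j or t_i = -t_j.\<close>
  have "Q = (\<lambda>x. m_const TYPE('n) a b \<iota> \<delta> * (\<Prod>j\<in>UNIV. (of_real (x $ j))\<^sup>2 - 1))"
  proof (rule polyf_eqI)
    show "polyf Q" using Q(1) by (simp add: rep_def)
    show "polyf (\<lambda>x. m_const TYPE('n) a b \<iota> \<delta> * (\<Prod>j\<in>UNIV. (of_real (x $ j))\<^sup>2 - 1))"
      by (intro polyf_intros)
    show "Q x = m_const TYPE('n) a b \<iota> \<delta> * (\<Prod>j\<in>UNIV. (of_real (x $ j))\<^sup>2 - 1)" if "reg x" for x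
      using reg_eq_trans[OF Q(2) foldr_M_poly_one] that by (simp add: reg_eq_def)
  qed
  then have "M_op a b \<iota> \<delta> (\<lambda>u. complex_of_real \<bar>SH u\<bar> powr \<delta>) t
      = m_const TYPE('n) a b \<iota> \<delta> * SH_powr (\<delta> - 2) t"
    using Q(1) t SH_powr_coth[OF t, of \<delta>] by (simp add: rep_def mult.assoc)
  then show ?thesis by (simp add: SH_powr_def)
qed

end
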